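(* Let $G$ be a nilpotent subgroup of $\mathrm{Homeo}(\mathbb{T}^2)$. Then there exists a finite index normal subgroup $H$ of $G$ containing $G_0$ such that $$\{\rho_\mu(\tilde\phi)\ ;\ \mu\in\mathcal{P}(\phi)\}=\{\rho_\nu(\tilde\phi)\ ;\ \nu\in\mathcal{P}(H)\}$$ for any lift $\tilde\phi$ of every $\phi\in G_0$. In particular, the set $\mathcal{I}_G$ of irrotational elements of $G$ is a normal subgroup of $G$. Moreover, if $G=G_0$ then $\mathcal{I}_G=G_{\mathcal{I}}$.
   Context: $\mathbb{T}^2=\mathbb{R}^2/\mathbb{Z}^2$. For a subgroup $G\subset\mathrm{Homeo}(\mathbb{T}^2)$, $G_0$ is the subgroup of elements of $G$ isotopic to the identity. $\mathcal{P}(\phi)$ is the set of $\phi$-invariant Borel probability measures on $\mathbb{T}^2$ and $\mathcal{P}(G)=\bigcap_{\psi\in G}\mathcal{P}(\psi)$. "Lift" means lift to the universal covering $\mathbb{R}^2$. For $\phi$ isotopic to the identity, a lift $\tilde\phi$ of $\phi$, and $\mu\in\mathcal{P}(\phi)$, $\rho_\mu(\tilde\phi):=\int_{\mathbb{T}^2}(\tilde\phi-\mathrm{Id})\,d\mu\in\mathbb{R}^2$ (note $\tilde\phi-\mathrm{Id}$ is well defined on $\mathbb{T}^2$). $\mathcal{I}_G:=\{\phi\in G_0 : \exists\text{ a lift }\tilde\phi\text{ of }\phi\text{ with }\rho_\mu(\tilde\phi)=(0,0)\text{ for all }\mu\in\mathcal{P}(\phi)\}$ (the irrotational elements of $G$).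 $G_{\mathcal{I}}:=\{\phi\in G_0 : \exists\text{ a lift }\tilde\phi\text{ of }\phi\text{ with }\rho_\mu(\tilde\phi)=(0,0)\text{ for all }\mu\in\mathcal{P}(G)\}$. *)

theory Defs
  imports "HOL-Probability.Probability" "HOL-Algebra.Coset" "HOL-Algebra.Generated_Groups"
begin

section \<open>The torus \<open>\<real>\<^sup>2 / \<int>\<^sup>2\<close>\<close>

definition int_rel :: "real ^ 2 \<Rightarrow> real ^ 2 \<Rightarrow> bool" where
  "int_rel v w \<longleftrightarrow> (\<forall>i. v $ i - w $ i \<in> \<int>)"

lemma equivp_int_rel: "equivp int_rel"
proof (rule equivpI)
  show "reflp int_rel"
    by (auto simp: int_rel_def reflp_def)
  show "symp int_rel"
    unfolding symp_def int_rel_def by (metis Ints_minus minus_diff_eq)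
  show "transp int_rel"
    unfolding transp_def int_rel_def
    by (metis (no_types, opaque_lifting) Ints_add diff_add_cancel add_diff_eq)
qed

quotient_type torus = "real ^ 2" / int_rel
  by (rule equivp_int_rel)

abbreviation proj :: "real ^ 2 \<Rightarrow> torus" where
  "proj \<equiv> abs_torus"

instantiation torus :: topological_space
begin

text \<open>The quotient topology.\<close>

definition open_torus :: "torus set \<Rightarrow> bool" where
  "open_torus U \<longleftrightarrow> open (proj -` U)"

instance
  by standard (auto simp: open_torus_def vimage_Int vimage_Union)

end

section \<open>Homeomorphisms, isotopies and lifts\<close>

definition Homeo_T2 :: "(torus \<Rightarrow> torus) monoid" where
  "Homeo_T2 = \<lparr>carrier = {f. homeomorphic_map euclidean euclidean f}, mult = (\<circ>), one = id\<rparr>"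

lemma group_Homeo_T2: "group Homeo_T2"
proof (rule groupI)
  fix f assume "f \<in> carrier Homeo_T2"
  then obtain g where "homeomorphic_maps (euclidean :: torus topology) euclidean f g"
    by (auto simp: Homeo_T2_def homeomorphic_map_maps)
  then have "homeomorphic_map (euclidean :: torus topology) euclidean g" "g \<circ> f = id"
    by (simp_all add: homeomorphic_maps_map fun_eq_iff)
  then show "\<exists>g \<in> carrier Homeo_T2. g \<otimes>\<^bsub>Homeo_T2\<^esub> f = \<one>\<^bsub>Homeo_T2\<^esub>"
    by (auto simp: Homeo_T2_def)
qed (auto simp: Homeo_T2_def intro: homeomorphic_map_compose)

definition isotopic_to_id :: "(torus \<Rightarrow> torus) \<Rightarrow> bool" where
  "isotopic_to_id \<phi> \<longleftrightarrow>
     homotopic_with (\<lambda>h. homeomorphic_map euclidean euclidean h) euclidean euclidean id \<phi>"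

text \<open>The isotopy runs in the full homeomorphism group, not in \<open>G\<close>.\<close>

definition id_part :: "(torus \<Rightarrow> torus) set \<Rightarrow> (torus \<Rightarrow> torus) set" where
  "id_part G = {\<phi> \<in> G. isotopic_to_id \<phi>}"

definition is_lift :: "(real ^ 2 \<Rightarrow> real ^ 2) \<Rightarrow> (torus \<Rightarrow> torus) \<Rightarrow> bool" where
  "is_lift F \<phi> \<longleftrightarrow> continuous_on UNIV F \<and> (\<forall>v. proj (F v) = \<phi> (proj v))"

section \<open>Invariant measures and rotation vectors\<close>

definition inv_measures :: "(torus \<Rightarrow> torus) \<Rightarrow> torus measure set" where
  "inv_measures \<phi> = {\<mu>. sets \<mu> = sets borel \<and> prob_space \<mu> \<and> distr \<mu> borel \<phi> = \<mu>}"

definition inv_measures_group :: "(torus \<Rightarrow> torus) set \<Rightarrow> torus measure set" where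
  "inv_measures_group G = (\<Inter>\<psi>\<in>G. inv_measures \<psi>)"

text \<open>
  \<open>F - Id\<close> as a function on the torus, evaluated at the representative \<open>rep_torus x\<close>
  of \<open>x\<close>. The choice is immaterial when \<open>F\<close> commutes with integer translations
  (lemma \<open>displacement_proj\<close>), as lifts of maps isotopic to the identity do.
\<close>

definition displacement :: "(real ^ 2 \<Rightarrow> real ^ 2) \<Rightarrow> torus \<Rightarrow> real ^ 2" where
  "displacement F x = F (rep_torus x) - rep_torus x"

lemma displacement_proj:
  assumes "\<And>v k. (\<forall>i. k $ i \<in> \<int>) \<Longrightarrow> F (v + k) = F v + k"
  shows "displacement F (proj v) = F v - v"
proof -
  define k where "k = rep_torus (proj v) - v"
  have "int_rel (rep_torus (proj v)) v"
    by (rule Quotient3_rep_abs[OF Quotient3_torus]) (simp add: int_rel_def)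
  then have "\<forall>i. k $ i \<in> \<int>"
    by (simp add: k_def int_rel_def)
  then have "F (v + k) = F v + k"
    by (rule assms)
  moreover have "rep_torus (proj v) = v + k"
    by (simp add: k_def)
  ultimately show ?thesis
    by (simp add: displacement_def)
qed

definition rot_vec :: "torus measure \<Rightarrow> (real ^ 2 \<Rightarrow> real ^ 2) \<Rightarrow> real ^ 2" where
  "rot_vec \<mu> F = (LINT x|\<mu>. displacement F x)"

definition irrotational :: "(torus \<Rightarrow> torus) set \<Rightarrow> (torus \<Rightarrow> torus) set" where
  "irrotational G =
     {\<phi> \<in> id_part G. \<exists>F. is_lift F \<phi> \<and> (\<forall>\<mu> \<in> inv_measures \<phi>. rot_vec \<mu> F = 0)}"

definition group_irrotational :: "(torus \<Rightarrow> torus) set \<Rightarrow> (torus \<Rightarrow> torus) set" where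
  "group_irrotational G =
     {\<phi> \<in> id_part G. \<exists>F. is_lift F \<phi> \<and> (\<forall>\<mu> \<in> inv_measures_group G. rot_vec \<mu> F = 0)}"

section \<open>Nilpotent groups\<close>

primrec lower_central :: "('a, 'b) monoid_scheme \<Rightarrow> nat \<Rightarrow> 'a set" where
  "lower_central K 0 = carrier K"
| "lower_central K (Suc n) = generate K
     {x \<otimes>\<^bsub>K\<^esub> y \<otimes>\<^bsub>K\<^esub> inv\<^bsub>K\<^esub> x \<otimes>\<^bsub>K\<^esub> inv\<^bsub>K\<^esub> y | x y. x \<in> lower_central K n \<and> y \<in> carrier K}"

definition nilpotent :: "('a, 'b) monoid_scheme \<Rightarrow> bool" where
  "nilpotent K \<longleftrightarrow> group K \<and> (\<exists>n. lower_central K n = {\<one>\<^bsub>K\<^esub>})"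

end

theory Submission
  imports Defs
begin

text \<open>
  Every homeomorphism \<open>g\<close> of the torus has a linear part \<open>A\<close> in \<open>GL(2, \<int>)\<close>, and \<open>A = 1\<close> for maps
  isotopic to the identity. Take for \<open>H\<close> the elements of \<open>G\<close> with \<open>A \<equiv> 1\<close> modulo \<open>3\<close>: such an \<open>A\<close>
  has determinant \<open>1\<close> and trace \<open>2\<close> or of modulus greater than \<open>2\<close>, so the only bounded two-sided
  orbits of the affine maps \<open>x \<mapsto> A (x + w)\<close> are the fixed points.

  Let \<open>\<Gamma>\<^sub>j\<close> be the part of the lower central series in \<open>H\<close>, let \<open>\<mu>\<close> be invariant under \<open>\<phi>\<close> and
  \<open>\<Gamma>\<^sub>j\<^sub>+\<^sub>1\<close>, and let \<open>g \<in> \<Gamma>\<^sub>j\<close>. Conjugating by \<open>g\<close> multiplies \<open>\<phi>\<close> by a commutator in \<open>\<Gamma>\<^sub>j\<^sub>+\<^sub>1\<close>, whose rotation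
  vector is, by induction down the series, the same for all push-forwards of \<open>\<mu>\<close> by powers of \<open>g\<close>.
  Hence the rotation vectors of \<open>\<phi>\<close> for these push-forwards form an orbit of some
  \<open>x \<mapsto> A (x + w)\<close>; it is bounded, and therefore constant. So the measures
  invariant under \<open>\<phi>\<close> and \<open>\<Gamma>\<^sub>j\<^sub>+\<^sub>1\<close> with a prescribed rotation vector of \<open>\<phi>\<close> form a compact convex set on
  which \<open>\<Gamma>\<^sub>j\<close> acts by commuting maps, and the Markov--Kakutani theorem yields one that is invariant
  under \<open>\<Gamma>\<^sub>j\<close>. Descending to \<open>\<Gamma>\<^sub>0 = H\<close> gives an \<open>H\<close>-invariant measure with the rotation vector of the
  \<open>\<phi>\<close>-invariant one we started from.

  Compactness is Tychonoff's theorem for normalized positive functionals (states) on continuous functions;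
  Riesz representation translates back to measures.
\<close>

section \<open>Riesz representation on compact metric spaces\<close>

text \<open>The value 0 on discontinuous functions makes a state a point of the product of real
  lines indexed by all functions. The product topology then induces weak-* convergence, and states
  that agree on continuous functions are equal.\<close>

definition state :: "(('a::topological_space \<Rightarrow> real) \<Rightarrow> real) \<Rightarrow> bool" where
  "state L \<longleftrightarrow>
     (\<forall>f. \<not> continuous_on UNIV f \<longrightarrow> L f = 0)
   \<and> (\<forall>f g. continuous_on UNIV f \<longrightarrow> continuous_on UNIV g \<longrightarrow> L (\<lambda>x. f x + g x) = L f + L g)
   \<and> (\<forall>c f. continuous_on UNIV f \<longrightarrow> L (\<lambda>x. c * f x) = c * L f)
   \<and> (\<forall>f. continuous_on UNIV f \<longrightarrow> (\<forall>x. 0 \<le> f x) \<longrightarrow> 0 \<le> L f)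
   \<and> L (\<lambda>x. 1) = 1"

lemma state_add:
  "state L \<Longrightarrow> continuous_on UNIV f \<Longrightarrow> continuous_on UNIV g \<Longrightarrow> L (\<lambda>x. f x + g x) = L f + L g"
  and state_scale: "state L \<Longrightarrow> continuous_on UNIV f \<Longrightarrow> L (\<lambda>x. c * f x) = c * L f"
  and state_nonneg: "state L \<Longrightarrow> continuous_on UNIV f \<Longrightarrow> (\<And>x. 0 \<le> f x) \<Longrightarrow> 0 \<le> L f"
  and state_one: "state L \<Longrightarrow> L (\<lambda>x. 1) = 1"
  and state_discontinuous: "state L \<Longrightarrow> \<not> continuous_on UNIV f \<Longrightarrow> L f = 0"
  by (simp_all add: state_def)

lemma state_const: "state L \<Longrightarrow> L (\<lambda>x. c) = c"
  using state_scale[of L "\<lambda>x. 1" c] state_one[of L] by simp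

lemma state_diff:
  assumes "state L" "continuous_on UNIV f" "continuous_on UNIV g"
  shows "L (\<lambda>x. f x - g x) = L f - L g"
proof -
  have "L (\<lambda>x. (f x - g x) + g x) = L (\<lambda>x. f x - g x) + L g"
    by (rule state_add[OF assms(1) continuous_on_diff[OF assms(2,3)] assms(3)])
  then show ?thesis by simp
qed

lemma state_mono:
  assumes "state L" "continuous_on UNIV f" "continuous_on UNIV g" "\<And>x. f x \<le> g x"
  shows "L f \<le> L g"
proof -
  have "0 \<le> L (\<lambda>x. g x - f x)"
    by (rule state_nonneg[OF assms(1) continuous_on_diff[OF assms(3,2)]]) (simp add: assms(4))
  then show ?thesis using state_diff[of L g f] assms by simp
qed

lemma state_sum:
  assumes "state L" "\<And>i. i \<in> I \<Longrightarrow> continuous_on UNIV (f i)"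
  shows "L (\<lambda>x. \<Sum>i\<in>I. f i x) = (\<Sum>i\<in>I. L (f i))"
  using assms(2)
proof (induction I rule: infinite_finite_induct)
  case (insert a I)
  have "L (\<lambda>x. f a x + (\<Sum>i\<in>I. f i x)) = L (f a) + L (\<lambda>x. \<Sum>i\<in>I. f i x)"
    using insert by (intro state_add[OF assms(1)] continuous_on_sum) auto
  then show ?case using insert by simp
qed (use state_const[OF assms(1), of 0] in simp_all)

lemma state_abs_le:
  assumes "state L" "\<And>x. \<bar>f x\<bar> \<le> c" "0 \<le> c"
  shows "\<bar>L f\<bar> \<le> c"
proof (cases "continuous_on UNIV f")
  case True
  then have "L f \<le> L (\<lambda>x. c)" "L (\<lambda>x. - c) \<le> L f"
    using assms(2) by (auto intro!: state_mono[OF assms(1)] simp: abs_le_iff minus_le_iff)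
  then show ?thesis using state_const[OF assms(1)] by (simp add: abs_le_iff)
qed (simp add: state_discontinuous[OF assms(1)] assms(3))

section \<open>The outer measure attached to a state\<close>

definition below_indicator :: "'a::topological_space set \<Rightarrow> ('a \<Rightarrow> real) set" where
  "below_indicator U = {f. continuous_on UNIV f \<and> (\<forall>x. 0 \<le> f x \<and> f x \<le> indicator U x)}"

text \<open>The value that a representing measure must give to an open set, since continuous
  functions approach its indicator from below; \<open>outer_content\<close> extends it by outer
  regularity.\<close>

definition open_content :: "(('a::topological_space \<Rightarrow> real) \<Rightarrow> real) \<Rightarrow> 'a set \<Rightarrow> ennreal" where
  "open_content L U = (SUP f \<in> below_indicator U. ennreal (L f))"

definition outer_content :: "(('a::topological_space \<Rightarrow> real) \<Rightarrow> real) \<Rightarrow> 'a set \<Rightarrow> ennreal" where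
  "outer_content L A = (INF U \<in> {U. open U \<and> A \<subseteq> U}. open_content L U)"

lemma below_indicatorD:
  assumes "f \<in> below_indicator U"
  shows "continuous_on UNIV f" "0 \<le> f x" "f x \<le> 1" "x \<notin> U \<Longrightarrow> f x = 0"
proof -
  have *: "0 \<le> f x" "f x \<le> indicator U x" using assms by (auto simp: below_indicator_def)
  show "continuous_on UNIV f" "0 \<le> f x" using assms by (auto simp: below_indicator_def)
  show "f x \<le> 1" using *(2) by (rule order_trans) (simp add: indicator_def)
  show "x \<notin> U \<Longrightarrow> f x = 0" using * by simp
qed

lemma below_indicatorI:
  assumes "continuous_on UNIV f" "\<And>x. 0 \<le> f x" "\<And>x. f x \<le> 1" "\<And>x. x \<notin> U \<Longrightarrow> f x \<le> 0"
  shows "f \<in> below_indicator U"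
  using assms by (auto simp: below_indicator_def indicator_def)

lemma open_content_upper: "f \<in> below_indicator U \<Longrightarrow> ennreal (L f) \<le> open_content L U"
  unfolding open_content_def by (rule SUP_upper)

lemma below_indicator_mono:
  assumes "U \<subseteq> V"
  shows "below_indicator U \<subseteq> below_indicator V"
proof
  fix f :: "'a \<Rightarrow> real" assume f: "f \<in> below_indicator U"
  show "f \<in> below_indicator V"
    by (rule below_indicatorI[OF below_indicatorD(1-3)[OF f]])
      (use assms below_indicatorD(4)[OF f] in \<open>metis order_refl subsetD\<close>)
qed

lemma open_content_mono: "U \<subseteq> V \<Longrightarrow> open_content L U \<le> open_content L V"
  unfolding open_content_def by (rule SUP_subset_mono[OF below_indicator_mono]) simp_all

lemma outer_content_open: "open U \<Longrightarrow> outer_content L U = open_content L U"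
  unfolding outer_content_def
  by (intro antisym INF_lower INF_greatest open_content_mono) auto

lemma outer_content_le: "open U \<Longrightarrow> A \<subseteq> U \<Longrightarrow> outer_content L A \<le> open_content L U"
  unfolding outer_content_def by (rule INF_lower) simp

lemma outer_content_mono: "A \<subseteq> B \<Longrightarrow> outer_content L A \<le> outer_content L B"
  unfolding outer_content_def by (rule INF_superset_mono) auto

lemma open_content_empty: "state L \<Longrightarrow> open_content L {} = 0"
proof -
  assume L: "state L"
  have "f = (\<lambda>x. 0)" if "f \<in> below_indicator {}" for f :: "'a \<Rightarrow> real"
    using below_indicatorD(4)[OF that] by auto
  then show ?thesis
    unfolding open_content_def using state_const[OF L, of 0]
    by (metis SUP_bot_conv(2) bot_ennreal ennreal_0)
qed

lemma open_content_UNIV: "state L \<Longrightarrow> open_content L UNIV = 1"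
proof (rule antisym)
  assume L: "state L"
  show "open_content L UNIV \<le> 1"
    unfolding open_content_def
  proof (rule SUP_least)
    fix f :: "'a \<Rightarrow> real" assume f: "f \<in> below_indicator UNIV"
    have "L f \<le> L (\<lambda>x. 1)"
      by (rule state_mono[OF L below_indicatorD(1)[OF f] continuous_on_const below_indicatorD(3)[OF f]])
    then show "ennreal (L f) \<le> 1" using state_one[OF L] by simp
  qed
  show "1 \<le> open_content L UNIV"
    using open_content_upper[of "\<lambda>x. 1" UNIV L] state_one[OF L]
    by (simp add: below_indicator_def)
qed

text \<open>Normalization turns a uniform error \<open>e\<close> between functions into an error of
  at most \<open>e\<close> between their values.\<close>

lemma state_le_add:
  assumes "state L" "continuous_on UNIV f" "continuous_on UNIV g" "\<And>x. f x \<le> g x + e"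
  shows "L f \<le> L g + e"
proof -
  have "L f \<le> L (\<lambda>x. g x + e)"
    by (rule state_mono[OF assms(1,2) continuous_on_add[OF assms(3) continuous_on_const] assms(4)])
  also have "\<dots> = L g + L (\<lambda>x. e)"
    by (rule state_add[OF assms(1,3) continuous_on_const])
  finally show ?thesis using state_const[OF assms(1)] by simp
qed

text \<open>For open \<open>U\<close> these functions increase with \<open>n\<close> to the
  indicator of \<open>U\<close>. The whole space is treated apart because \<open>infdist\<close> to
  the empty set is 0 by convention, which would give the zero function.\<close>

definition urysohn :: "'a::metric_space set \<Rightarrow> nat \<Rightarrow> 'a \<Rightarrow> real" where
  "urysohn U n x = (if U = UNIV then 1 else min 1 (real n * infdist x (- U)))"

lemma continuous_urysohn [continuous_intros]: "continuous_on UNIV (urysohn U n)"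
  unfolding urysohn_def by (cases "U = UNIV"; simp) (intro continuous_intros)

lemma urysohn_nonneg [simp]: "0 \<le> urysohn U n x"
  by (simp add: urysohn_def infdist_nonneg)

lemma urysohn_le_1 [simp]: "urysohn U n x \<le> 1"
  by (simp add: urysohn_def)

lemma urysohn_below: "open U \<Longrightarrow> urysohn U n \<in> below_indicator U"
  by (rule below_indicatorI[OF continuous_urysohn urysohn_nonneg urysohn_le_1]) (auto simp: urysohn_def)

lemma urysohn_mono: "m \<le> n \<Longrightarrow> urysohn U m x \<le> urysohn U n x"
proof -
  assume "m \<le> n"
  then have "real m * infdist x (- U) \<le> real n * infdist x (- U)"
    by (intro mult_right_mono) (simp_all add: infdist_nonneg)
  then show ?thesis by (auto simp: urysohn_def)
qed

lemma urysohn_eq_1: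
  assumes "open U" "x \<in> U"
  shows "\<exists>N. \<forall>n\<ge>N. urysohn U n x = 1"
proof (cases "U = UNIV")
  case False
  have "closed (- U)" using assms(1) by (rule closed_Compl)
  then have "infdist x (- U) > 0"
    using in_closed_iff_infdist_zero[of "- U" x] False assms infdist_nonneg[of x "- U"]
    by fastforce
  then obtain N where N: "1 < real N * infdist x (- U)"
    using reals_Archimedean3 by blast
  have "urysohn U n x = 1" if "n \<ge> N" for n
  proof -
    have "real N * infdist x (- U) \<le> real n * infdist x (- U)"
      using that by (intro mult_right_mono) (auto simp: infdist_nonneg)
    then show ?thesis using N False by (simp add: urysohn_def)
  qed
  then show ?thesis by blast
qed (simp add: urysohn_def)

text \<open>A continuous \<open>f\<close> below the indicator of a countable union is, by compactness, up to \<open>e\<close>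
  below a finite sum of Urysohn functions.\<close>

lemma open_content_countably_subadditive:
  fixes L :: "('a::metric_space \<Rightarrow> real) \<Rightarrow> real" and U :: "nat \<Rightarrow> 'a set"
  assumes L: "state L" and X: "compact (UNIV :: 'a set)" and U: "\<And>n. open (U n)"
  shows "open_content L (\<Union>n. U n) \<le> (\<Sum>n. open_content L (U n))"
  unfolding open_content_def[of L "\<Union>n. U n"]
proof (rule SUP_least)
  fix f :: "'a \<Rightarrow> real" assume f: "f \<in> below_indicator (\<Union>n. U n)"
  \<comment> \<open>One index \<open>N\<close> bounds both the number of terms and the steepness of
    each; this makes \<open>s\<close> increasing in \<open>N\<close>, so that a finite subcover is
    absorbed by its largest index.\<close>
  define s where "s N x = (\<Sum>n<N. urysohn (U n) N x)" for N x
  have cs: "continuous_on UNIV (s N)" for N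
    unfolding s_def by (intro continuous_intros)
  have s_mono: "s M x \<le> s N x" if "M \<le> N" for M N x
  proof -
    have "s M x \<le> (\<Sum>n<M. urysohn (U n) N x)"
      unfolding s_def by (intro sum_mono urysohn_mono that)
    also have "\<dots> \<le> s N x"
      unfolding s_def using that by (intro sum_mono2) auto
    finally show ?thesis .
  qed
  show "ennreal (L f) \<le> (\<Sum>n. open_content L (U n))"
  proof (rule ennreal_le_epsilon)
    fix e :: real assume e: "0 < e"
    define V where "V N = {x. f x < s N x + e}" for N
    have oV: "open (V N)" for N
      unfolding V_def using cs[of N] below_indicatorD(1)[OF f]
      by (auto intro!: open_Collect_less continuous_intros)
    have "UNIV \<subseteq> (\<Union>N\<in>UNIV. V N)"
    proof
      fix x
      show "x \<in> (\<Union>N\<in>UNIV. V N)"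
      proof (cases "\<exists>n. x \<in> U n")
        case True
        then obtain n M where n: "x \<in> U n" and M: "\<forall>m\<ge>M. urysohn (U n) m x = 1"
          using urysohn_eq_1[OF U] by metis
        define N where "N = max M (Suc n)"
        have "1 = (\<Sum>k\<in>{n}. urysohn (U k) N x)" using M by (simp add: N_def)
        also have "\<dots> \<le> s N x"
          unfolding s_def by (intro sum_mono2) (auto simp: N_def)
        finally have "f x < s N x + e" using below_indicatorD(3)[OF f, of x] e by linarith
        then show ?thesis by (auto simp: V_def)
      next
        case False
        then have "f x = 0" using below_indicatorD(4)[OF f] by blast
        then have "f x < s 0 x + e" using e by (simp add: s_def)
        then show ?thesis by (auto simp: V_def)
      qed
    qed
    then obtain K where K: "finite K" "UNIV \<subseteq> (\<Union>N\<in>K. V N)"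
      using compactE_image[OF X, of UNIV V] oV by metis
    define N where "N = Max (insert 0 K)"
    have "f x \<le> s N x + e" for x
    proof -
      obtain M where M: "M \<in> K" "x \<in> V M" using K by blast
      then have "M \<le> N" using K by (simp add: N_def)
      then show ?thesis using M s_mono[of M N x] by (simp add: V_def)
    qed
    then have "L f \<le> L (s N) + e"
      using cs below_indicatorD(1)[OF f] by (intro state_le_add[OF L])
    also have "L (s N) = (\<Sum>n<N. L (urysohn (U n) N))"
      unfolding s_def by (intro state_sum[OF L] continuous_urysohn)
    finally have "ennreal (L f) \<le> ennreal ((\<Sum>n<N. L (urysohn (U n) N)) + e)"
      by (rule ennreal_leI)
    also have "\<dots> = (\<Sum>n<N. ennreal (L (urysohn (U n) N))) + ennreal e"
      using e by (subst ennreal_plus) (simp_all add: sum_nonneg state_nonneg[OF L] continuous_urysohn flip: sum_ennreal)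
    also have "\<dots> \<le> (\<Sum>n<N. open_content L (U n)) + ennreal e"
      by (intro add_right_mono sum_mono open_content_upper urysohn_below U)
    also have "\<dots> \<le> (\<Sum>n. open_content L (U n)) + ennreal e"
      by (intro add_right_mono sum_le_suminf) auto
    finally show "ennreal (L f) \<le> (\<Sum>n. open_content L (U n)) + ennreal e" .
  qed
qed

lemma outer_measure_space_outer_content:
  fixes L :: "('a::metric_space \<Rightarrow> real) \<Rightarrow> real"
  assumes L: "state L" and X: "compact (UNIV :: 'a set)"
  shows "outer_measure_space UNIV (outer_content L)"
  unfolding outer_measure_space_def
proof (intro conjI)
  show "positive UNIV (outer_content L)"
    using outer_content_open[of "{}" L] open_content_empty[OF L] by (simp add: positive_def)
  show "increasing UNIV (outer_content L)"
    by (simp add: increasing_def outer_content_mono)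
  show "countably_subadditive UNIV (outer_content L)"
    unfolding countably_subadditive_def
  proof (intro allI impI)
    fix A :: "nat \<Rightarrow> 'a set"
    \<comment> \<open>Finiteness makes the addition of a positive error a strict increase, so that
      some open superset of \<open>A n\<close> comes within the error of the infimum; the errors
      form a geometric series of sum \<open>e\<close>.\<close>
    have fin: "outer_content L B < top_class.top" for B
      using outer_content_mono[of B UNIV L] open_content_UNIV[OF L]
      by (metis ennreal_one_less_top leD not_less_iff_gr_or_eq open_UNIV outer_content_open subset_UNIV top.not_eq_extremum)
    show "outer_content L (\<Union>i. A i) \<le> (\<Sum>i. outer_content L (A i))"
    proof (rule ennreal_le_epsilon)
      fix e :: real assume e: "0 < e"
      have "\<exists>U. open U \<and> A n \<subseteq> U \<and> open_content L U \<le> outer_content L (A n) + ennreal (e * (1/2)^Suc n)" for n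
      proof -
        have "outer_content L (A n) < outer_content L (A n) + ennreal (e * (1/2)^Suc n)"
          using fin[of "A n"] e ennreal_add_left_cancel_less[of "outer_content L (A n)" 0] by simp
        then show ?thesis
          by (subst (asm) (1) outer_content_def) (auto simp: INF_less_iff intro: less_imp_le)
      qed
      then obtain U where U: "\<And>n. open (U n)" "\<And>n. A n \<subseteq> U n"
        "\<And>n. open_content L (U n) \<le> outer_content L (A n) + ennreal (e * (1/2)^Suc n)"
        by metis
      have "outer_content L (\<Union>i. A i) \<le> open_content L (\<Union>i. U i)"
        using U by (intro outer_content_le) auto
      also have "\<dots> \<le> (\<Sum>n. open_content L (U n))"
        by (intro open_content_countably_subadditive L X U)
      also have "\<dots> \<le> (\<Sum>n. outer_content L (A n) + ennreal (e * (1/2)^Suc n))"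
        by (intro suminf_le U) auto
      also have "\<dots> = (\<Sum>n. outer_content L (A n)) + (\<Sum>n. ennreal (e * (1/2)^Suc n))"
        by (intro suminf_add[symmetric]) auto
      also have "(\<Sum>n. ennreal (e * (1/2)^Suc n)) = ennreal e"
      proof (rule suminf_ennreal_eq)
        show "(\<lambda>n. e * (1/2)^Suc n) sums e"
          using sums_mult[OF power_half_series, of e] by simp
      qed (use e in simp)
      finally show "outer_content L (\<Union>i. A i) \<le> (\<Sum>n. outer_content L (A n)) + ennreal e" .
    qed
  qed
qed

text \<open>Caratheodory measurability is first tested on open \<open>V\<close>, where a function
  below \<open>U \<inter> V\<close> and one concentrated near \<open>V - U\<close> can be combined
  below \<open>V\<close> at an arbitrarily small cost. Outer regularity passes to arbitrary
  sets.\<close>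

lemma open_in_lambda_system:
  fixes L :: "('a::metric_space \<Rightarrow> real) \<Rightarrow> real"
  assumes L: "state L" and X: "compact (UNIV :: 'a set)" and U: "open U"
  shows "U \<in> lambda_system UNIV UNIV (outer_content L)"
proof -
  have split: "outer_content L (U \<inter> V) + outer_content L ((UNIV - U) \<inter> V) \<le> open_content L V"
    if V: "open V" for V
  proof -
    have oUV: "open (U \<inter> V)" using U V by auto
    have "open_content L (U \<inter> V) + outer_content L ((UNIV - U) \<inter> V) =
        (SUP f \<in> below_indicator (U \<inter> V). ennreal (L f) + outer_content L ((UNIV - U) \<inter> V))"
      unfolding open_content_def
      by (rule ennreal_SUP_add_left[symmetric]) (auto simp: below_indicator_def intro!: exI[of _ "\<lambda>x. 0"])
    also have "\<dots> \<le> open_content L V"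
    proof (rule SUP_least)
      fix f assume f: "f \<in> below_indicator (U \<inter> V)"
      show "ennreal (L f) + outer_content L ((UNIV - U) \<inter> V) \<le> open_content L V"
      proof (rule ennreal_le_epsilon)
        fix e :: real assume e: "0 < e"
        \<comment> \<open>An open neighbourhood of \<open>V - U\<close> inside \<open>V\<close> on
          which \<open>f\<close> is negligible, since \<open>f\<close> vanishes outside
          \<open>U\<close>.\<close>
        define W where "W = V \<inter> {x. f x < e}"
        have oW: "open W"
          unfolding W_def using V below_indicatorD(1)[OF f]
          by (intro open_Int open_Collect_less continuous_intros)
        have "(UNIV - U) \<inter> V \<subseteq> W"
          using below_indicatorD(4)[OF f] e by (auto simp: W_def)
        then have "ennreal (L f) + outer_content L ((UNIV - U) \<inter> V) \<le> ennreal (L f) + open_content L W"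
          by (intro add_left_mono outer_content_le oW)
        also have "\<dots> = (SUP g \<in> below_indicator W. ennreal (L f) + ennreal (L g))"
          unfolding open_content_def
          by (rule ennreal_SUP_add_right) (auto simp: below_indicator_def intro!: exI[of _ "\<lambda>x. 0"])
        also have "\<dots> \<le> open_content L V + ennreal e"
        proof (rule SUP_least)
          fix g assume g: "g \<in> below_indicator W"
          \<comment> \<open>The truncation of \<open>f\<close> vanishes on \<open>W\<close> and
            \<open>g\<close> vanishes off \<open>W\<close>, so the sum stays at most 1; it lies at
            most \<open>e\<close> below \<open>f + g\<close>.\<close>
          define h where "h x = max (f x - e) 0 + g x" for x
          have ch: "continuous_on UNIV h"
            unfolding h_def using below_indicatorD(1)[OF f] below_indicatorD(1)[OF g]
            by (auto intro!: continuous_intros)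
          have "h \<in> below_indicator V"
          proof (rule below_indicatorI)
            fix x
            show "0 \<le> h x" using below_indicatorD(2)[OF g, of x] by (simp add: h_def)
            show "h x \<le> 1"
              using below_indicatorD(3,4)[OF g, of x] below_indicatorD(3)[OF f, of x] e
              by (cases "x \<in> W") (auto simp: h_def W_def)
            show "h x \<le> 0" if "x \<notin> V"
              using below_indicatorD(4)[OF g, of x] below_indicatorD(4)[OF f, of x] e that
              by (auto simp: h_def W_def)
          qed (rule ch)
          have "ennreal (L f) + ennreal (L g) = ennreal (L f + L g)"
            by (intro ennreal_plus[symmetric] state_nonneg[OF L] below_indicatorD(1,2)[OF f] below_indicatorD(1,2)[OF g])
          also have "L f + L g = L (\<lambda>x. f x + g x)"
            by (intro state_add[OF L, symmetric] below_indicatorD(1)[OF f] below_indicatorD(1)[OF g])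
          also have "ennreal \<dots> \<le> ennreal (L h + e)"
            by (intro ennreal_leI state_le_add[OF L] ch continuous_on_add below_indicatorD(1)[OF f] below_indicatorD(1)[OF g])
              (simp add: h_def)
          also have "\<dots> = ennreal (L h) + ennreal e"
            using e by (intro ennreal_plus state_nonneg[OF L] ch below_indicatorD(2)[OF \<open>h \<in> below_indicator V\<close>]) auto
          also have "\<dots> \<le> open_content L V + ennreal e"
            by (intro add_right_mono open_content_upper \<open>h \<in> below_indicator V\<close>)
          finally show "ennreal (L f) + ennreal (L g) \<le> open_content L V + ennreal e" .
        qed
        finally show "ennreal (L f) + outer_content L ((UNIV - U) \<inter> V) \<le> open_content L V + ennreal e" .
      qed
    qed
    finally show ?thesis by (simp add: outer_content_open[OF oUV])
  qed
  have ge: "outer_content L (U \<inter> A) + outer_content L ((UNIV - U) \<inter> A) \<le> outer_content L A" for A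
    unfolding outer_content_def[of L A]
  proof (rule INF_greatest)
    fix V assume "V \<in> {V. open V \<and> A \<subseteq> V}"
    then have V: "open V" "A \<subseteq> V" by auto
    then have "outer_content L (U \<inter> A) + outer_content L ((UNIV - U) \<inter> A)
        \<le> outer_content L (U \<inter> V) + outer_content L ((UNIV - U) \<inter> V)"
      by (intro add_mono outer_content_mono) auto
    then show "outer_content L (U \<inter> A) + outer_content L ((UNIV - U) \<inter> A) \<le> open_content L V"
      using split[OF V(1)] by (rule order_trans)
  qed
  have le: "outer_content L A \<le> outer_content L (U \<inter> A) + outer_content L ((UNIV - U) \<inter> A)" for A
  proof -
    interpret P: sigma_algebra UNIV "UNIV :: 'a set set"
      using sigma_algebra_Pow[of "UNIV :: 'a set"] by simp
    have oms: "positive UNIV (outer_content L)" "countably_subadditive UNIV (outer_content L)"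
      using outer_measure_space_outer_content[OF L X] by (auto simp: outer_measure_space_def)
    have "subadditive UNIV (outer_content L)"
      by (rule P.countably_subadditive_subadditive[OF oms])
    then have "outer_content L ((U \<inter> A) \<union> ((UNIV - U) \<inter> A)) \<le> outer_content L (U \<inter> A) + outer_content L ((UNIV - U) \<inter> A)"
      by (rule subadditiveD) auto
    moreover have "(U \<inter> A) \<union> ((UNIV - U) \<inter> A) = A" by auto
    ultimately show ?thesis by simp
  qed
  show ?thesis using ge le by (auto simp: lambda_system_def intro: antisym)
qed

section \<open>Layer sums and the representing measure\<close>

text \<open>At each point the number of levels \<open>k < n\<close> lying below
  \<open>n * f x\<close> is at most the ceiling of \<open>n * f x\<close>, hence at most
  \<open>n * f x + 1\<close>; integrating this count gives the bound.\<close>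

lemma integral_dominates_layer_sum:
  assumes M: "prob_space M" and f: "f \<in> borel_measurable M"
    and bnd: "\<And>x. 0 \<le> f x" "\<And>x. f x \<le> (1::real)" and n: "0 < n"
  shows "(\<Sum>k<n. measure M {x\<in>space M. real k / n < f x}) / n \<le> (LINT x|M. f x) + 1 / n"
proof -
  interpret prob_space M by fact
  have m[measurable]: "{x\<in>space M. real k / n < f x} \<in> sets M" for k
    using f by measurable
  have count: "(\<Sum>k<n. indicator {x\<in>space M. real k / n < f x} x :: real) \<le> n * f x + 1" for x
  proof -
    define S where "S = {k. k < n \<and> real k < n * f x}"
    have "(\<Sum>k<n. indicator {x\<in>space M. real k / n < f x} x :: real) \<le> (\<Sum>k<n. if k \<in> S then 1 else 0)"
    proof (rule sum_mono)
      fix k assume "k \<in> {..<n}"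
      moreover have "real k / n < f x \<longleftrightarrow> real k < n * f x" using n by (simp add: field_simps)
      ultimately show "indicator {x\<in>space M. real k / n < f x} x \<le> (if k \<in> S then 1 else 0 :: real)"
        by (simp add: S_def indicator_def)
    qed
    also have "\<dots> = real (card S)"
    proof -
      have "{..<n} \<inter> S = S" by (auto simp: S_def)
      then show ?thesis by (simp add: sum.If_cases)
    qed
    also have "\<dots> \<le> n * f x + 1"
    proof -
      have "S \<subseteq> {..< nat \<lceil>n * f x\<rceil>}" by (simp add: S_def subset_iff zless_nat_eq_int_zless less_ceiling_iff)
      then have "card S \<le> nat \<lceil>n * f x\<rceil>" using card_mono[of "{..< nat \<lceil>n * f x\<rceil>}" S] by simp
      moreover have "0 \<le> n * f x" using bnd(1)[of x] by simp
      ultimately show ?thesis by linarith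
    qed
    finally show ?thesis .
  qed
  have int: "integrable M f"
    by (rule integrable_const_bound[where B = 1]) (use f bnd in auto)
  have "(\<Sum>k<n. measure M {x\<in>space M. real k / n < f x})
      = (LINT x|M. (\<Sum>k<n. indicator {x\<in>space M. real k / n < f x} x))"
    by (subst Bochner_Integration.integral_sum) (simp_all add: less_top[symmetric])
  also have "\<dots> \<le> (LINT x|M. n * f x + 1)"
    by (intro integral_mono count) (auto intro!: int simp: less_top[symmetric])
  also have "\<dots> = n * (LINT x|M. f x) + 1"
    using int by (simp add: prob_space)
  finally show ?thesis using n by (simp add: field_simps)
qed

text \<open>The function \<open>n * f\<close> is cut into horizontal slices \<open>g k\<close>
  between the heights \<open>k\<close> and \<open>k + 1\<close>. Each slice lies below the indicator
  of the corresponding superlevel set, where \<open>M\<close> dominates \<open>L\<close>.\<close>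

lemma state_le_layer_sum:
  fixes L :: "('a::metric_space \<Rightarrow> real) \<Rightarrow> real"
  assumes L: "state L" and f: "continuous_on UNIV f" and bnd: "\<And>x. 0 \<le> f x" "\<And>x. f x \<le> 1" and n: "0 < n"
    and M: "\<And>U g. open U \<Longrightarrow> g \<in> below_indicator U \<Longrightarrow> L g \<le> measure M U"
  shows "L f \<le> (\<Sum>k<n. measure M {x. real k / n < f x}) / n"
proof -
  define g where "g k x = min 1 (max (n * f x - real k) 0)" for k :: nat and x
  have cg: "continuous_on UNIV (g k)" for k
    unfolding g_def using f by (intro continuous_intros)
  have layers: "(\<Sum>k<m. min 1 (max (t - real k) 0)) = min t (real m)" if "0 \<le> t" for t :: real and m :: nat
  proof (induction m)
    case (Suc m)
    then show ?case by (auto simp: min_def max_def)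
  qed (use that in simp)
  have sum_g: "(\<Sum>k<n. g k x) = n * f x" for x
    unfolding g_def using layers[of "n * f x" n] bnd[of x] n
    by (simp add: min_def mult_le_cancel_left1)
  have "n * L f = L (\<lambda>x. n * f x)" using state_scale[OF L f] by simp
  also have "\<dots> = L (\<lambda>x. \<Sum>k<n. g k x)" by (simp add: sum_g)
  also have "\<dots> = (\<Sum>k<n. L (g k))" by (rule state_sum[OF L cg])
  also have "\<dots> \<le> (\<Sum>k<n. measure M {x. real k / n < f x})"
  proof (intro sum_mono M)
    fix k
    show "open {x. real k / n < f x}"
      using f n by (auto intro!: open_Collect_less continuous_intros)
    show "g k \<in> below_indicator {x. real k / n < f x}"
      by (rule below_indicatorI[OF cg]) (use n in \<open>auto simp: g_def field_simps\<close>)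
  qed
  finally show ?thesis using n by (simp add: field_simps)
qed

text \<open>Caratheodory's construction yields a Borel measure. Layer sums give only that
  \<open>L f\<close> is at most the integral; the same inequality for \<open>1 - f\<close> gives the
  converse, and an affine rescaling reduces every continuous function to values in the unit
  interval.\<close>

theorem riesz_representation:
  fixes L :: "('a::metric_space \<Rightarrow> real) \<Rightarrow> real"
  assumes L: "state L" and X: "compact (UNIV :: 'a set)"
  obtains M where "sets M = sets borel" "prob_space M"
    "\<And>f. continuous_on UNIV f \<Longrightarrow> (LINT x|M. f x) = L f"
proof -
  interpret P: sigma_algebra UNIV "UNIV :: 'a set set"
    using sigma_algebra_Pow[of "UNIV :: 'a set"] by simp
  let ?ls = "lambda_system UNIV UNIV (outer_content L)"
  have ms: "measure_space UNIV ?ls (outer_content L)"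
    by (rule P.caratheodory_lemma[OF outer_measure_space_outer_content[OF L X]])
  then have "sigma_sets UNIV {U. open U} \<subseteq> ?ls"
    by (intro sigma_algebra.sigma_sets_subset) (auto simp: measure_space_def open_in_lambda_system[OF L X])
  then have ms': "measure_space UNIV (sigma_sets UNIV {U::'a set. open U}) (outer_content L)"
    by (rule measure_down[OF ms sigma_algebra_sigma_sets, rotated]) auto
  define M where "M = measure_of UNIV (sigma_sets UNIV {U::'a set. open U}) (outer_content L)"
  have sets_M: "sets M = sets borel"
    using ms' by (simp add: M_def borel_def measure_space_def sigma_algebra.sigma_sets_eq)
  have space_M: "space M = UNIV" using sets_eq_imp_space_eq[OF sets_M] by simp
  have em: "emeasure M A = outer_content L A" if "A \<in> sets borel" for A
    unfolding M_def using that ms'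
    by (intro emeasure_measure_of_sigma) (auto simp: measure_space_def borel_def)
  have "emeasure M UNIV = 1"
    using em[of UNIV] outer_content_open[of UNIV L] open_content_UNIV[OF L] by simp
  then have pM: "prob_space M" by (intro prob_spaceI) (simp add: space_M)
  interpret prob_space M by fact
  have le_M: "L g \<le> measure M U" if "open U" "g \<in> below_indicator U" for U g
  proof -
    have "ennreal (L g) \<le> ennreal (measure M U)"
      using open_content_upper[OF that(2), of L] that
      by (simp add: emeasure_eq_measure[symmetric] em outer_content_open)
    then show ?thesis by (simp add: ennreal_le_iff)
  qed
  have meas: "f \<in> borel_measurable M" if "continuous_on UNIV f" for f :: "'a \<Rightarrow> real"
    using borel_measurable_continuous_onI[OF that] measurable_cong_sets[OF sets_M refl] by blast
  have le: "L f \<le> (LINT x|M. f x)"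
    if f: "continuous_on UNIV f" and bnd: "\<And>x. 0 \<le> f x" "\<And>x. f x \<le> 1" for f
  proof (rule field_le_epsilon)
    fix e :: real assume "0 < e"
    then obtain n :: nat where n: "n > 0" "1 / n < e" using nat_approx_posE by (metis zero_less_Suc)
    have "L f \<le> (\<Sum>k<n. measure M {x. real k / n < f x}) / n"
      by (rule state_le_layer_sum) (use L f bnd n le_M in auto)
    also have "\<dots> \<le> (LINT x|M. f x) + 1 / n"
      using integral_dominates_layer_sum[OF pM meas[OF f] bnd n(1)] by (simp add: space_M)
    finally show "L f \<le> (LINT x|M. f x) + e" using n by simp
  qed
  have eq01: "(LINT x|M. f x) = L f"
    if f: "continuous_on UNIV f" and bnd: "\<And>x. 0 \<le> f x" "\<And>x. f x \<le> 1" for f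
  proof (rule antisym)
    have "L (\<lambda>x. 1 - f x) \<le> (LINT x|M. 1 - f x)"
      using bnd by (intro le continuous_intros f) auto
    moreover have "integrable M f"
      by (rule integrable_const_bound[where B = 1]) (use meas[OF f] bnd in auto)
    moreover have "L (\<lambda>x. 1 - f x) = 1 - L f"
      using state_diff[OF L _ f, of "\<lambda>x. 1"] state_one[OF L] by simp
    ultimately show "(LINT x|M. f x) \<le> L f"
      by (simp add: prob_space)
  qed (rule le[OF f bnd])
  show thesis
  proof (rule that[OF sets_M pM])
    fix f :: "'a \<Rightarrow> real" assume f: "continuous_on UNIV f"
    obtain B where B: "\<And>x. \<bar>f x\<bar> \<le> B" "B > 0"
    proof -
      have "bounded (range f)" by (intro compact_imp_bounded compact_continuous_image f X)
      then show ?thesis using that by (auto simp: bounded_pos)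
    qed
    define h where "h x = (f x + B) / (2 * B)" for x
    have ch: "continuous_on UNIV h"
      unfolding h_def using f B(2) by (auto intro!: continuous_intros)
    have hb: "0 \<le> h x" "h x \<le> 1" for x
      using B(1)[of x] B(2) by (auto simp: h_def field_simps abs_le_iff)
    have f_eq: "f = (\<lambda>x. 2 * B * h x - B)"
      using B(2) by (auto simp: h_def)
    have "integrable M h"
      by (rule integrable_const_bound[where B = 1]) (use meas[OF ch] hb in auto)
    then have "(LINT x|M. f x) = 2 * B * L h - B"
      using eq01[OF ch hb] by (subst f_eq) (simp add: prob_space)
    moreover have "L f = 2 * B * L h - B"
      using state_diff[OF L, of "\<lambda>x. 2 * B * h x" "\<lambda>x. B"] state_scale[OF L ch] ch state_const[OF L]
      by (subst f_eq) (simp add: continuous_intros)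
    ultimately show "(LINT x|M. f x) = L f" by simp
  qed
qed

text \<open>By dominated convergence the Urysohn functions recover the measure of every open set,
  and open sets form an intersection-stable generator of the Borel sets.\<close>

lemma prob_measure_eqI_continuous:
  fixes M N :: "'a::metric_space measure"
  assumes M: "sets M = sets borel" "prob_space M" and N: "sets N = sets borel" "prob_space N"
    and eq: "\<And>f. continuous_on UNIV f \<Longrightarrow> (\<And>x. 0 \<le> f x) \<Longrightarrow> (\<And>x. f x \<le> (1::real)) \<Longrightarrow> (LINT x|M. f x) = (LINT x|N. f x)"
  shows "M = N"
proof -
  have lim: "(\<lambda>n. LINT x|K. urysohn U n x) \<longlonglongrightarrow> measure K U"
    if K: "sets K = sets borel" "prob_space K" and U: "open U" for K :: "'a measure" and U
  proof -
    interpret K: prob_space K by fact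
    have meas: "urysohn U n \<in> borel_measurable K" for n
      using borel_measurable_continuous_onI[OF continuous_urysohn]
        measurable_cong_sets[OF K(1) refl] by blast
    have "(\<lambda>n. LINT x|K. urysohn U n x) \<longlonglongrightarrow> (LINT x|K. indicator U x)"
    proof (rule integral_dominated_convergence[where w = "\<lambda>x. 1"])
      show "AE x in K. (\<lambda>n. urysohn U n x) \<longlonglongrightarrow> indicator U x"
      proof (rule AE_I2)
        fix x
        show "(\<lambda>n. urysohn U n x) \<longlonglongrightarrow> indicator U x"
        proof (cases "x \<in> U")
          case True
          then have "eventually (\<lambda>n. urysohn U n x = 1) sequentially"
            using urysohn_eq_1[OF U] by (auto simp: eventually_sequentially)
          then show ?thesis using True by (simp add: tendsto_eventually)
        next
          case False
          then show ?thesis using below_indicatorD(4)[OF urysohn_below[OF U]] by simp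
        qed
      qed
      show "AE x in K. norm (urysohn U n x) \<le> 1" for n
        by simp
    qed (use meas K(1) borel_open[OF U] in simp_all)
    then show ?thesis using U K sets_eq_imp_space_eq[OF K(1)] by simp
  qed
  interpret M: prob_space M by fact
  interpret N: prob_space N by fact
  show ?thesis
  proof (rule measure_eqI_generator_eq[where E = "{U. open U}" and \<Omega> = UNIV and A = "\<lambda>_. UNIV"])
    show "Int_stable {U::'a set. open U}" by (auto simp: Int_stable_def)
    show "sets M = sigma_sets UNIV {U. open U}" "sets N = sigma_sets UNIV {U. open U}"
      using M N by (auto simp: borel_def)
    fix U :: "'a set" assume "U \<in> {U. open U}"
    then have U: "open U" by simp
    have "(LINT x|M. urysohn U n x) = (LINT x|N. urysohn U n x)" for n
      by (intro eq continuous_urysohn) auto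
    then have "measure M U = measure N U"
      using LIMSEQ_unique[OF lim[OF M U]] lim[OF N U] by simp
    then show "emeasure M U = emeasure N U"
      by (simp add: M.emeasure_eq_measure N.emeasure_eq_measure)
  qed auto
qed

section \<open>A Markov--Kakutani fixed point theorem\<close>

text \<open>Tychonoff's theorem, phrased for the topology of the function type, in which states
  live.\<close>

lemma compact_PiE_coordinatewise:
  fixes S :: "'i \<Rightarrow> 'b::topological_space set"
  assumes "\<And>i. compact (S i)"
  shows "compact {x. \<forall>i. x i \<in> S i}"
proof -
  have "compactin (product_topology (\<lambda>i. euclidean) UNIV) (Pi\<^sub>E UNIV S)"
    using assms by (simp add: compactin_PiE)
  moreover have "Pi\<^sub>E UNIV S = {x. \<forall>i. x i \<in> S i}"
    by (auto simp: PiE_def extensional_def Pi_def)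
  ultimately show ?thesis
    by (simp add: euclidean_product_topology compactin_euclidean_iff)
qed

text \<open>Ergodic averages of an orbit stay in \<open>C\<close> by convexity and move by at most
  \<open>2 * B i / (n + 1)\<close> in coordinate \<open>i\<close> when composed with
  \<open>s\<close>. Compactness yields a point that does not move at all.\<close>

lemma fixed_point_composition:
  fixes C :: "('i \<Rightarrow> real) set"
  assumes C: "compact C" "C \<noteq> {}"
    and convex: "\<And>x y t. x \<in> C \<Longrightarrow> y \<in> C \<Longrightarrow> 0 \<le> t \<Longrightarrow> t \<le> 1 \<Longrightarrow> (\<lambda>i. (1 - t) * x i + t * y i) \<in> C"
    and inv: "\<And>x. x \<in> C \<Longrightarrow> x \<circ> s \<in> C"
  obtains x where "x \<in> C" "x \<circ> s = x"
proof -
  have "\<exists>B. \<forall>x\<in>C. \<bar>x i\<bar> \<le> B" for i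
  proof -
    have "compact ((\<lambda>x. x i) ` C)"
      by (intro compact_continuous_image C) (rule continuous_on_subset[OF continuous_on_product_coordinates], simp)
    then show ?thesis by (auto dest!: compact_imp_bounded simp: bounded_iff)
  qed
  then obtain B where B: "\<And>i x. x \<in> C \<Longrightarrow> \<bar>x i\<bar> \<le> B i" by metis
  define D where "D n = {x. \<forall>i. \<bar>x (s i) - x i\<bar> \<le> 2 * B i / real (n + 1)}" for n :: nat
  have closed_D: "closed (D n)" for n
    unfolding D_def
    by (intro closed_Collect_all closed_Collect_le) (auto intro!: continuous_intros)
  have B_nonneg: "0 \<le> B i" for i using B C(2) by (metis abs_ge_zero ex_in_conv order_trans)
  have D_mono: "D m \<subseteq> D n" if "n \<le> m" for m n
  proof
    fix x assume x: "x \<in> D m"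
    have "2 * B i / real (m + 1) \<le> 2 * B i / real (n + 1)" for i
      using that B_nonneg by (intro divide_left_mono) auto
    then show "x \<in> D n" using x unfolding D_def by (auto intro: order_trans)
  qed
  obtain x0 where x0: "x0 \<in> C" using C by blast
  have iter: "x0 \<circ> (s ^^ k) \<in> C" for k
  proof (induction k)
    case (Suc k)
    have "x0 \<circ> (s ^^ Suc k) = (x0 \<circ> (s ^^ k)) \<circ> s"
      by (auto simp: fun_eq_iff funpow_swap1)
    then show ?case using inv[OF Suc] by (simp only:)
  qed (use x0 in simp)
  define a where "a n = (\<lambda>i. (\<Sum>k\<le>n. x0 ((s ^^ k) i)) / real (n + 1))" for n :: nat
  have a_C: "a n \<in> C" for n
  proof (induction n)
    case 0
    then show ?case using x0 by (simp add: a_def)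
  next
    case (Suc n)
    \<comment> \<open>With this weight the average of \<open>n + 2\<close> orbit points is a convex
      combination of the previous average and the next orbit point.\<close>
    define t where "t = 1 / real (n + 2)"
    have "a (Suc n) = (\<lambda>i. (1 - t) * a n i + t * (x0 \<circ> (s ^^ Suc n)) i)"
    proof
      fix i
      have "(1 - t) * a n i = (\<Sum>k\<le>n. x0 ((s ^^ k) i)) / real (n + 2)"
      proof -
        have "1 - t = real (n + 1) / real (n + 2)" by (simp add: t_def field_simps)
        then show ?thesis by (simp add: a_def)
      qed
      then show "a (Suc n) i = (1 - t) * a n i + t * (x0 \<circ> (s ^^ Suc n)) i"
        by (simp add: a_def t_def add_divide_distrib)
    qed
    then show ?case using convex[OF Suc iter, of t "Suc n"] by (simp add: t_def)
  qed
  have a_D: "a n \<in> D n" for n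
    unfolding D_def
  proof (intro CollectI allI)
    fix i
    have "(\<Sum>k\<le>n. x0 ((s ^^ k) (s i))) - (\<Sum>k\<le>n. x0 ((s ^^ k) i)) = x0 ((s ^^ Suc n) i) - x0 i"
      by (induction n) (simp_all add: funpow_swap1)
    then have "a n (s i) - a n i = (x0 ((s ^^ Suc n) i) - x0 i) / real (n + 1)"
      by (simp add: a_def diff_divide_distrib[symmetric])
    moreover have "\<bar>x0 ((s ^^ Suc n) i) - x0 i\<bar> \<le> 2 * B i"
      using B[OF x0, of i] B[OF iter[of "Suc n"], of i] by (simp add: abs_le_iff)
    ultimately show "\<bar>a n (s i) - a n i\<bar> \<le> 2 * B i / real (n + 1)"
      by (simp add: divide_right_mono)
  qed
  have "C \<inter> (\<Inter>n\<in>UNIV. D n) \<noteq> {}"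
  proof (rule compact_imp_fip_image[OF C(1) closed_D])
    fix I :: "nat set" assume "finite I"
    then have "a (Max (insert 0 I)) \<in> D n" if "n \<in> I" for n
      using a_D D_mono[of n "Max (insert 0 I)"] that by auto
    then show "C \<inter> (\<Inter>n\<in>I. D n) \<noteq> {}" using a_C by blast
  qed
  then obtain x where x: "x \<in> C" "\<And>n. x \<in> D n" by blast
  have "x (s i) = x i" for i
  proof (rule ccontr)
    assume "x (s i) \<noteq> x i"
    then have "0 < \<bar>x (s i) - x i\<bar>" by simp
    then obtain n where "2 * B i < real n * \<bar>x (s i) - x i\<bar>"
      using reals_Archimedean3 by blast
    moreover have "\<bar>x (s i) - x i\<bar> * real (n + 1) \<le> 2 * B i"
      using x(2)[of n] by (simp add: D_def field_simps)
    ultimately show False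
      by (simp add: algebra_simps)
  qed
  then show thesis using that x(1) by (auto simp: fun_eq_iff)
qed

text \<open>The maps act by precomposition on coordinates, hence linearly and continuously.
  Commutation is asked for only at the points of \<open>C\<close>, because in the application it
  holds only modulo maps that fix these points. The finite intersection property reduces to finitely
  many maps.\<close>

theorem markov_kakutani_composition:
  fixes C :: "('i \<Rightarrow> real) set"
  assumes C: "compact C" "C \<noteq> {}"
    and convex: "\<And>x y t. x \<in> C \<Longrightarrow> y \<in> C \<Longrightarrow> 0 \<le> t \<Longrightarrow> t \<le> 1 \<Longrightarrow> (\<lambda>i. (1 - t) * x i + t * y i) \<in> C"
    and inv: "\<And>x s. x \<in> C \<Longrightarrow> s \<in> S \<Longrightarrow> x \<circ> s \<in> C"
    and comm: "\<And>x s t. x \<in> C \<Longrightarrow> s \<in> S \<Longrightarrow> t \<in> S \<Longrightarrow> x \<circ> s \<circ> t = x \<circ> t \<circ> s"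
  obtains x where "x \<in> C" "\<And>s. s \<in> S \<Longrightarrow> x \<circ> s = x"
proof -
  define Fix where "Fix s = {x :: 'i \<Rightarrow> real. x \<circ> s = x}" for s
  have "Fix s = {x. \<forall>i. x (s i) = x i}" for s by (auto simp: Fix_def fun_eq_iff)
  then have closed_Fix: "closed (Fix s)" for s
    by (auto intro!: closed_Collect_all closed_Collect_eq)
  have "C \<inter> (\<Inter>s\<in>S. Fix s) \<noteq> {}"
  proof (rule compact_imp_fip_image[OF C(1) closed_Fix])
    fix F assume "finite F" "F \<subseteq> S"
    then show "C \<inter> (\<Inter>s\<in>F. Fix s) \<noteq> {}"
    proof (induction F rule: finite_induct)
      case (insert s F)
      let ?D = "C \<inter> (\<Inter>s\<in>F. Fix s)"
      have "compact ?D" by (intro compact_Int_closed C closed_INT ballI closed_Fix)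
      moreover have "?D \<noteq> {}" using insert by simp
      moreover have "(\<lambda>i. (1 - r) * x i + r * y i) \<in> ?D" if "x \<in> ?D" "y \<in> ?D" "0 \<le> r" "r \<le> 1" for x y r
        using that convex by (auto simp: Fix_def fun_eq_iff)
      \<comment> \<open>Commutation keeps the common fixed points of the maps in \<open>F\<close>
        invariant under \<open>s\<close>.\<close>
      moreover have "x \<circ> s \<in> ?D" if "x \<in> ?D" for x
        using that inv insert.prems comm[of x s] by (fastforce simp: Fix_def)
      ultimately obtain x where "x \<in> ?D" "x \<circ> s = x" by (rule fixed_point_composition) auto
      then show ?case by (auto simp: Fix_def)
    qed (use C in simp)
  qed
  then show thesis using that by (auto simp: Fix_def)
qed

text \<open>As in the Banach-Alaoglu theorem: states form a closed subset of a product of compact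
  intervals, whose sizes are bounds of the functions on the compact space.\<close>

lemma compact_states:
  assumes X: "compact (UNIV :: 'a::topological_space set)"
  shows "compact {L :: ('a \<Rightarrow> real) \<Rightarrow> real. state L}"
proof -
  have "\<exists>b. \<forall>L. state L \<longrightarrow> \<bar>L f\<bar> \<le> b" for f :: "'a \<Rightarrow> real"
  proof (cases "continuous_on UNIV f")
    case True
    then have "bounded (range f)" using X by (intro compact_imp_bounded compact_continuous_image)
    then obtain c where "c > 0" "\<And>x. \<bar>f x\<bar> \<le> c" by (auto simp: bounded_pos)
    then show ?thesis using state_abs_le[of _ f c] by fastforce
  next
    case False
    then show ?thesis by (intro exI[of _ 0]) (simp add: state_discontinuous)
  qed
  then obtain b :: "('a \<Rightarrow> real) \<Rightarrow> real" where b: "\<And>L f. state L \<Longrightarrow> \<bar>L f\<bar> \<le> b f" by metis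
  have "closed {L :: ('a \<Rightarrow> real) \<Rightarrow> real. state L}"
    unfolding state_def
    by (intro closed_Collect_conj closed_Collect_all closed_Collect_imp closed_Collect_eq
        closed_Collect_le open_Collect_const continuous_intros continuous_on_product_coordinates)
  then have "compact ({L. \<forall>f. L f \<in> {- b f .. b f}} \<inter> {L :: ('a \<Rightarrow> real) \<Rightarrow> real. state L})"
    by (intro compact_Int_closed compact_PiE_coordinatewise compact_Icc)
  moreover have "{L. \<forall>f. L f \<in> {- b f .. b f}} \<inter> {L. state L} = {L. state L}"
    using b by (auto simp: abs_le_iff) (metis abs_le_iff minus_le_iff)
  ultimately show ?thesis by simp
qed

lemma state_convex:
  assumes "state L" "state M" "0 \<le> t" "t \<le> 1"
  shows "state (\<lambda>f. (1 - t) * L f + t * M f)"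
proof -
  have "0 \<le> (1 - t) * a + t * b" if "0 \<le> a" "0 \<le> b" for a b
    using assms(3,4) that by simp
  then show ?thesis
    using assms(1,2) unfolding state_def by (simp add: distrib_left mult.left_commute)
qed

section \<open>Metric structure of the torus, lifts and linear parts\<close>

definition int_vec :: "real ^ 2 \<Rightarrow> bool" where
  "int_vec k \<longleftrightarrow> (\<forall>i. k $ i \<in> \<int>)"

definition int_mat :: "real ^ 2 ^ 2 \<Rightarrow> bool" where
  "int_mat A \<longleftrightarrow> (\<forall>i j. A $ i $ j \<in> \<int>)"

lemma int_vec_0 [simp]: "int_vec 0"
  and int_vec_uminus: "int_vec k \<Longrightarrow> int_vec (- k)"
  by (simp_all add: int_vec_def)

lemma int_vec_axis [simp]: "int_vec (axis i 1)"
  by (simp add: int_vec_def axis_def)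

lemma int_vec_matrix_vector_mult: "int_mat A \<Longrightarrow> int_vec k \<Longrightarrow> int_vec (A *v k)"
  by (simp add: int_vec_def int_mat_def matrix_vector_mult_def Ints_mult Ints_sum)

lemma int_mat_mult: "int_mat A \<Longrightarrow> int_mat B \<Longrightarrow> int_mat (A ** B)"
  by (simp add: int_mat_def matrix_matrix_mult_def Ints_mult Ints_sum)

lemma int_mat_1 [simp]: "int_mat (mat 1)"
  by (simp add: int_mat_def mat_def)

lemma proj_eq_iff: "proj v = proj w \<longleftrightarrow> int_vec (v - w)"
  by (simp add: torus.abs_eq_iff int_rel_def int_vec_def)

lemma proj_add_int_vec: "int_vec k \<Longrightarrow> proj (v + k) = proj v"
  by (simp add: proj_eq_iff)

lemma proj_rep_torus [simp]: "proj (rep_torus x) = x"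
  by (rule Quotient3_abs_rep[OF Quotient3_torus])

lemma cis_2pi_eq_iff: "cis (2 * pi * a) = cis (2 * pi * b) \<longleftrightarrow> a - b \<in> \<int>"
proof -
  have "cis (2 * pi * a) = cis (2 * pi * b) \<longleftrightarrow> cis (2 * pi * (a - b)) = 1"
    by (simp add: right_diff_distrib cis_divide[symmetric])
  also have "\<dots> \<longleftrightarrow> cos (2 * pi * (a - b)) = 1"
    using sin_cos_squared_add[of "2 * pi * (a - b)"] by (auto simp: complex_eq_iff power2_eq_square)
  also have "\<dots> \<longleftrightarrow> a - b \<in> \<int>"
  proof -
    have "2 * pi * (a - b) = of_int n * 2 * pi \<longleftrightarrow> a - b = of_int n" for n
      using pi_gt_zero by auto
    then show ?thesis unfolding cos_one_2pi_int Ints_def by (auto simp: image_iff)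
  qed
  finally show ?thesis .
qed

section \<open>The embedding into pairs of complex numbers and its metric\<close>

text \<open>The torus as a product of two unit circles. Its chord distance becomes the metric
  \<open>dist_torus\<close>, and its coordinates are the circle-valued maps whose logarithms give
  lifts.\<close>

lift_definition torus_embed :: "torus \<Rightarrow> complex ^ 2" is "\<lambda>v. \<chi> i. cis (2 * pi * v $ i)"
  by (simp add: int_rel_def vec_eq_iff cis_2pi_eq_iff)

lemma torus_embed_eq_iff [simp]: "torus_embed x = torus_embed y \<longleftrightarrow> x = y"
  by transfer (simp add: int_rel_def vec_eq_iff cis_2pi_eq_iff)

lemma torus_embed_proj: "torus_embed (proj v) = (\<chi> i. cis (2 * pi * v $ i))"
  by (simp add: torus_embed.abs_eq)

lemma continuous_torus_embed_proj: "continuous_on UNIV (\<lambda>v. torus_embed (proj v))"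
  unfolding torus_embed_proj by (intro continuous_on_vec_lambda continuous_intros)

lemma ex_proj_unit_square: "\<exists>v \<in> cbox 0 1. x = proj v"
proof -
  let ?v = "\<chi> i. frac (rep_torus x $ i)"
  have "proj ?v = proj (rep_torus x)"
    unfolding proj_eq_iff by (simp add: int_vec_def frac_def)
  moreover have "?v \<in> cbox 0 1"
    by (simp add: mem_box_cart less_imp_le[OF frac_lt_1])
  ultimately show ?thesis by (metis proj_rep_torus)
qed

text \<open>The quotient topology is the one induced by the embedding. The complement of an open set
  is covered by a compact part of the unit square, so its image is compact and keeps a positive
  distance from the image of any point of the set.\<close>

lemma open_torus_iff_embed:
  fixes U :: "torus set"
  shows "open U \<longleftrightarrow> (\<forall>x\<in>U. \<exists>e>0. \<forall>y. dist (torus_embed x) (torus_embed y) < e \<longrightarrow> y \<in> U)"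
proof (intro iffI ballI)
  fix x assume U: "open U" and x: "x \<in> U"
  let ?K = "(\<lambda>v. torus_embed (proj v)) ` (cbox 0 1 \<inter> proj -` (- U))"
  have "open (proj -` U)" using U by (simp add: open_torus_def)
  then have "closed (- (proj -` U))" by (rule closed_Compl)
  then have "compact (cbox 0 1 \<inter> proj -` (- U))"
    by (intro compact_Int_closed compact_cbox) (simp add: vimage_Compl)
  then have "compact ?K"
    by (intro compact_continuous_image continuous_on_subset[OF continuous_torus_embed_proj]) auto
  then have "open (- ?K)" by (intro open_Compl compact_imp_closed)
  moreover have "torus_embed x \<in> - ?K" using x by auto
  ultimately obtain e where e: "e > 0" "ball (torus_embed x) e \<subseteq> - ?K"
    by (meson open_contains_ball)
  have "y \<in> U" if "dist (torus_embed x) (torus_embed y) < e" for y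
  proof (rule ccontr)
    assume "y \<notin> U"
    then have "torus_embed y \<in> ?K" using ex_proj_unit_square[of y] by blast
    then show False using e that by auto
  qed
  then show "\<exists>e>0. \<forall>y. dist (torus_embed x) (torus_embed y) < e \<longrightarrow> y \<in> U"
    using e by blast
next
  assume U: "\<forall>x\<in>U. \<exists>e>0. \<forall>y. dist (torus_embed x) (torus_embed y) < e \<longrightarrow> y \<in> U"
  show "open U"
    unfolding open_torus_def
  proof (subst open_subopen, intro ballI)
    fix v assume "v \<in> proj -` U"
    then obtain e where e: "e > 0" "\<And>y. dist (torus_embed (proj v)) (torus_embed y) < e \<Longrightarrow> y \<in> U"
      using U by auto
    let ?T = "{w. dist (torus_embed (proj v)) (torus_embed (proj w)) < e}"
    have "open ?T"
      by (intro open_Collect_less continuous_on_dist continuous_on_const continuous_torus_embed_proj)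
    moreover have "v \<in> ?T" "?T \<subseteq> proj -` U" using e by auto
    ultimately show "\<exists>T. open T \<and> v \<in> T \<and> T \<subseteq> proj -` U" by blast
  qed
qed

instantiation torus :: metric_space
begin

definition dist_torus :: "torus \<Rightarrow> torus \<Rightarrow> real" where
  "dist_torus x y = dist (torus_embed x) (torus_embed y)"

definition uniformity_torus :: "(torus \<times> torus) filter" where
  "uniformity_torus = (INF e\<in>{0<..}. principal {(x, y). dist x y < e})"

instance
proof
  show "uniformity = (INF e\<in>{0<..}. principal {(x :: torus, y). dist x y < e})"
    by (rule uniformity_torus_def)
  show "open U \<longleftrightarrow> (\<forall>x\<in>U. \<forall>\<^sub>F (x', y) in uniformity. x' = x \<longrightarrow> y \<in> U)" for U :: "torus set"
  proof -
    have "(\<forall>\<^sub>F (x', y) in uniformity. x' = x \<longrightarrow> y \<in> U) \<longleftrightarrow> (\<exists>e>0. \<forall>y. dist x y < e \<longrightarrow> y \<in> U)" for x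
      unfolding uniformity_torus_def
    proof (subst eventually_INF_base)
      fix a b :: real assume "a \<in> {0<..}" "b \<in> {0<..}"
      then show "\<exists>e\<in>{0<..}. principal {(x :: torus, y). dist x y < e}
          \<le> inf (principal {(x, y). dist x y < a}) (principal {(x, y). dist x y < b})"
        by (auto intro!: bexI[of _ "min a b"])
    qed (auto simp: eventually_principal)
    then show ?thesis by (simp add: open_torus_iff_embed dist_torus_def)
  qed
  show "dist x y = 0 \<longleftrightarrow> x = y" for x y :: torus by (simp add: dist_torus_def)
  show "dist x y \<le> dist x z + dist y z" for x y z :: torus
    unfolding dist_torus_def by (rule dist_triangle2)
qed

end

text \<open>The universal property of the quotient topology, which lets continuity be checked in the
  plane.\<close>

lemma continuous_on_torus_iff:
  fixes f :: "torus \<Rightarrow> 'b::topological_space"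
  shows "continuous_on UNIV f \<longleftrightarrow> continuous_on UNIV (\<lambda>v. f (proj v))"
  by (simp add: continuous_on_open_vimage open_torus_def vimage_def)

lemma continuous_proj: "continuous_on UNIV proj"
  using continuous_on_torus_iff[of id] by (simp add: id_def)

lemma continuous_torus_embed: "continuous_on UNIV torus_embed"
  by (simp add: continuous_on_torus_iff continuous_torus_embed_proj)

lemma compact_torus: "compact (UNIV :: torus set)"
proof -
  have "UNIV = proj ` cbox 0 1" using ex_proj_unit_square by blast
  moreover have "compact (proj ` cbox 0 1)"
    by (intro compact_continuous_image continuous_on_subset[OF continuous_proj] compact_cbox subset_UNIV)
  ultimately show ?thesis by simp
qed

section \<open>Lifts and their action on integer translations\<close>

text \<open>On a contractible set each circle-valued coordinate has a continuous logarithm; it is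
  purely imaginary, and dividing by \<open>2 * pi\<close> gives the coordinate of the lift.\<close>

lemma lift_to_plane:
  fixes f :: "'a::real_normed_vector \<Rightarrow> torus"
  assumes "contractible S" and f: "continuous_on S f"
  obtains F where "continuous_on S F" "\<And>v. v \<in> S \<Longrightarrow> proj (F v) = f v"
proof -
  have norm_embed: "norm (torus_embed x $ i) = 1" for x i
    using torus_embed_proj[of "rep_torus x"] by simp
  have "\<exists>g. continuous_on S g \<and> (\<forall>v\<in>S. torus_embed (f v) $ i = exp (g v))" for i
  proof -
    have "continuous_on S (\<lambda>v. torus_embed (f v))"
      by (rule continuous_on_compose2[OF continuous_torus_embed f]) simp
    then have "continuous_on S (\<lambda>v. torus_embed (f v) $ i)"
      by (intro continuous_intros)
    moreover have "torus_embed (f v) $ i \<noteq> 0" for v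
      using norm_embed[of "f v" i] by auto
    ultimately obtain g where "continuous_on S g" "\<And>v. v \<in> S \<Longrightarrow> torus_embed (f v) $ i = exp (g v)"
      using continuous_logarithm_on_contractible[OF _ assms(1)] by blast
    then show ?thesis by blast
  qed
  then obtain g where g: "\<And>i. continuous_on S (g i)" "\<And>i v. v \<in> S \<Longrightarrow> torus_embed (f v) $ i = exp (g i v)"
    by metis
  define F where "F v = (\<chi> i. Im (g i v) / (2 * pi))" for v
  show thesis
  proof
    show "continuous_on S F"
      unfolding F_def by (intro continuous_on_vec_lambda continuous_intros g) auto
    fix v assume v: "v \<in> S"
    have "cis (Im (g i v)) = torus_embed (f v) $ i" for i
    proof -
      have "exp (Re (g i v)) = 1" using norm_embed[of "f v" i] g(2)[OF v, of i] by simp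
      then show ?thesis using g(2)[OF v, of i] by (simp add: exp_eq_polar)
    qed
    then have "torus_embed (proj (F v)) = torus_embed (f v)"
      by (simp add: torus_embed_proj F_def vec_eq_iff)
    then show "proj (F v) = f v" by simp
  qed
qed

lemma int_vec_valued_constant:
  fixes f :: "'a::topological_space \<Rightarrow> real ^ 2"
  assumes "connected S" "continuous_on S f" "\<And>v. v \<in> S \<Longrightarrow> int_vec (f v)" "v \<in> S" "w \<in> S"
  shows "f v = f w"
proof -
  have "f v $ i = f w $ i" for i
  proof -
    have "(\<lambda>v. f v $ i) constant_on S"
    proof (rule continuous_discrete_range_constant[OF assms(1)])
      show "continuous_on S (\<lambda>v. f v $ i)" by (intro continuous_intros assms(2))
      fix x assume "x \<in> S"
      have "1 \<le> norm (f y $ i - f x $ i)" if "y \<in> S" "f y $ i \<noteq> f x $ i" for y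
        using assms(3)[OF \<open>x \<in> S\<close>] assms(3)[OF \<open>y \<in> S\<close>] that
          Ints_nonzero_abs_ge1[of "f y $ i - f x $ i"]
        by (simp add: int_vec_def)
      then show "\<exists>e>0. \<forall>y. y \<in> S \<and> f y $ i \<noteq> f x $ i \<longrightarrow> e \<le> norm (f y $ i - f x $ i)"
        by (intro exI[of _ 1]) auto
    qed
    then show ?thesis using assms(4,5) by (auto simp: constant_on_def)
  qed
  then show ?thesis by (simp add: vec_eq_iff)
qed

lemma lifts_differ_by_int_vec:
  assumes "is_lift F g" "is_lift F' g"
  obtains k where "int_vec k" "\<And>v. F' v = F v + k"
proof
  have int: "int_vec (F' v - F v)" for v
    using assms by (simp add: is_lift_def flip: proj_eq_iff)
  then show "int_vec (F' 0 - F 0)" .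
  fix v
  have "F' v - F v = F' 0 - F 0"
    by (rule int_vec_valued_constant[of UNIV]) (use int assms in \<open>auto simp: is_lift_def intro!: continuous_on_diff\<close>)
  then show "F' v = F v + (F' 0 - F 0)" by (simp add: algebra_simps)
qed

text \<open>For a lift \<open>F\<close> of a torus map, \<open>A\<close> is the induced action on
  the fundamental group, identified with the integer lattice.\<close>

definition equivariant :: "(real ^ 2 \<Rightarrow> real ^ 2) \<Rightarrow> real ^ 2 ^ 2 \<Rightarrow> bool" where
  "equivariant F A \<longleftrightarrow> (\<forall>v k. int_vec k \<longrightarrow> F (v + k) = F v + A *v k)"

lemma equivariantD: "equivariant F A \<Longrightarrow> int_vec k \<Longrightarrow> F (v + k) = F v + A *v k"
  by (simp add: equivariant_def)

lemma equivariant_mat_1D: "equivariant F (mat 1) \<Longrightarrow> int_vec k \<Longrightarrow> F (v + k) = F v + k"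
  by (simp add: equivariant_def)

lemma additive_on_multiples:
  fixes a :: "real ^ 2 \<Rightarrow> real ^ 2"
  assumes add: "\<And>k l. int_vec k \<Longrightarrow> int_vec l \<Longrightarrow> a (k + l) = a k + a l" and e: "int_vec e"
  shows "a (of_int n *\<^sub>R e) = of_int n *\<^sub>R a e"
proof -
  have a0: "a 0 = 0" using add[of 0 0] by simp
  have mult: "int_vec (of_int n *\<^sub>R e)" for n :: int using e by (simp add: int_vec_def)
  have neg: "a (- k) = - a k" if "int_vec k" for k
    using add[OF that int_vec_uminus[OF that]] a0 by (simp add: eq_neg_iff_add_eq_0 add.commute)
  have nat: "a (of_int (int m) *\<^sub>R e) = of_int (int m) *\<^sub>R a e" for m
  proof (induction m)
    case (Suc m)
    have "a (of_int (int m) *\<^sub>R e + e) = a (of_int (int m) *\<^sub>R e) + a e"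
      by (rule add[OF mult e])
    then show ?case using Suc by (simp add: scaleR_left_distrib add.commute)
  qed (simp add: a0)
  show ?thesis
  proof (cases "0 \<le> n")
    case True
    then show ?thesis using nat[of "nat n"] by simp
  next
    case False
    then show ?thesis using nat[of "nat (- n)"] neg[OF mult[of "- n"]] by simp
  qed
qed

text \<open>The increments \<open>F (v + k) - F v\<close> are integral and continuous in
  \<open>v\<close>, hence independent of \<open>v\<close>. They are therefore additive in
  \<open>k\<close> and given by a matrix.\<close>

lemma equivariant_lift_matrix:
  assumes g: "is_lift F g"
  obtains A where "int_mat A" "equivariant F A"
proof -
  define a where "a k = F k - F 0" for k
  have int: "int_vec (F (v + k) - F v)" if "int_vec k" for v k
    using g that by (simp add: is_lift_def proj_add_int_vec flip: proj_eq_iff)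
  have cont: "continuous_on UNIV (\<lambda>v. F (v + k) - F v)" for k
    using g unfolding is_lift_def
    by (intro continuous_on_diff continuous_on_compose2[of UNIV F UNIV "\<lambda>v. v + k"] continuous_intros) auto
  have shift: "F (v + k) = F v + a k" if "int_vec k" for v k
  proof -
    have "F (v + k) - F v = F (0 + k) - F 0"
      by (rule int_vec_valued_constant[of UNIV _ v 0]) (use int[OF that] cont in auto)
    then show ?thesis by (simp add: a_def algebra_simps)
  qed
  have add: "a (k + l) = a k + a l" if "int_vec k" "int_vec l" for k l
    using shift[of l k] that by (simp add: a_def)
  define A where "A = (\<chi> i j. a (axis j 1) $ i)"
  show thesis
  proof
    show "int_mat A"
      using int[OF int_vec_axis, of 0] by (auto simp: int_mat_def A_def a_def int_vec_def)
    have "a k = A *v k" if k: "int_vec k" for k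
    proof -
      obtain m n where mn: "k $ 1 = of_int m" "k $ 2 = of_int n"
        using k by (metis Ints_cases int_vec_def)
      have k_eq: "k = of_int m *\<^sub>R axis 1 1 + of_int n *\<^sub>R axis 2 1"
        by (simp add: vec_eq_iff forall_2 mn axis_def)
      have "a k = a (of_int m *\<^sub>R axis 1 1) + a (of_int n *\<^sub>R axis 2 1)"
        unfolding k_eq by (rule add) (auto simp: int_vec_def axis_def)
      also have "\<dots> = of_int m *\<^sub>R a (axis 1 1) + of_int n *\<^sub>R a (axis 2 1)"
        using add by (simp add: additive_on_multiples)
      finally show ?thesis
        by (simp add: vec_eq_iff A_def matrix_vector_mult_def sum_2 mn mult.commute)
    qed
    then show "equivariant F A" using shift by (simp add: equivariant_def)
  qed
qed

lemma equivariant_unique: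
  assumes "equivariant F A" "equivariant F B"
  shows "A = B"
proof -
  have "A *v axis j 1 = B *v axis j 1" for j
    using assms[THEN equivariantD, of "axis j 1" 0] by simp
  then have "column j A = column j B" for j
    by (simp add: matrix_vector_mul_component matrix_vector_mult_basis)
  then show ?thesis by (simp add: vec_eq_iff column_def)
qed

lemma equivariant_compose:
  "equivariant F A \<Longrightarrow> equivariant F' B \<Longrightarrow> int_mat B \<Longrightarrow> equivariant (F \<circ> F') (A ** B)"
  by (simp add: equivariant_def int_vec_matrix_vector_mult matrix_vector_mul_assoc)

lemma equivariant_id: "equivariant id (mat 1)"
  by (simp add: equivariant_def)

lemma is_lift_id: "is_lift id id"
  by (simp add: is_lift_def)

lemma is_lift_compose: "is_lift F g \<Longrightarrow> is_lift F' h \<Longrightarrow> is_lift (F \<circ> F') (g \<circ> h)"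
  unfolding is_lift_def by (auto intro!: continuous_on_compose2[of UNIV F UNIV F'] simp: o_def)

lemma is_lift_translate: "is_lift F g \<Longrightarrow> int_vec k \<Longrightarrow> is_lift (\<lambda>v. F v + k) g"
  unfolding is_lift_def by (auto intro!: continuous_intros simp: proj_add_int_vec)

lemma ex_lift:
  assumes "continuous_on UNIV g"
  obtains F where "is_lift F g"
proof -
  have "continuous_on UNIV (\<lambda>v. g (proj v))" using assms by (simp add: continuous_on_torus_iff)
  then show thesis
    using lift_to_plane[of "UNIV :: (real ^ 2) set" "\<lambda>v. g (proj v)"] that
    by (auto simp: is_lift_def contractible_UNIV)
qed

text \<open>One lift suffices: two lifts differ by a constant and share their matrix
  (\<open>equivariant_lift\<close>), so the relation determines \<open>A\<close>.\<close>

definition linear_part :: "(torus \<Rightarrow> torus) \<Rightarrow> real ^ 2 ^ 2 \<Rightarrow> bool" where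
  "linear_part g A \<longleftrightarrow> int_mat A \<and> (\<exists>F. is_lift F g \<and> equivariant F A)"

lemma linear_part_int_mat: "linear_part g A \<Longrightarrow> int_mat A"
  by (simp add: linear_part_def)

lemma ex_linear_part: "continuous_on UNIV g \<Longrightarrow> \<exists>A. linear_part g A"
  by (metis ex_lift equivariant_lift_matrix linear_part_def)

lemma equivariant_lift:
  assumes "linear_part g A" "is_lift F g"
  shows "equivariant F A"
proof -
  obtain F' where "is_lift F' g" and F': "equivariant F' A"
    using assms(1) by (auto simp: linear_part_def)
  then obtain k where "\<And>v. F v = F' v + k" using lifts_differ_by_int_vec assms(2) by metis
  then show ?thesis using F' by (simp add: equivariant_def)
qed

lemma linear_part_unique: "linear_part g A \<Longrightarrow> linear_part g B \<Longrightarrow> A = B"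
  by (metis equivariant_lift equivariant_unique linear_part_def)

lemma linear_part_compose: "linear_part g A \<Longrightarrow> linear_part h B \<Longrightarrow> linear_part (g \<circ> h) (A ** B)"
  unfolding linear_part_def by (metis equivariant_compose int_mat_mult is_lift_compose)

lemma linear_part_id: "linear_part id (mat 1)"
  unfolding linear_part_def using is_lift_id equivariant_id int_mat_1 by blast

text \<open>Any lift of the inverse becomes a left inverse of \<open>F\<close> after an integer
  translation. As \<open>F \<circ> F'\<close> is itself a translation, evaluating it at
  \<open>F 0\<close> shows that it is the identity.\<close>

lemma inverse_lift:
  assumes F: "is_lift F g" and h: "continuous_on UNIV h" "h \<circ> g = id" "g \<circ> h = id"
  obtains F' where "is_lift F' h" "F' \<circ> F = id" "F \<circ> F' = id"
proof -
  obtain F0 where F0: "is_lift F0 h" using ex_lift[OF h(1)] .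
  have "is_lift (F0 \<circ> F) id" using is_lift_compose[OF F0 F] h by simp
  then obtain k where k: "int_vec k" "\<And>v. (F0 \<circ> F) v = id v + k"
    using lifts_differ_by_int_vec[OF is_lift_id] by metis
  define F' where "F' = (\<lambda>v. F0 v + - k)"
  have F': "is_lift F' h" unfolding F'_def by (intro is_lift_translate F0 int_vec_uminus k)
  have left: "F' \<circ> F = id" using k by (auto simp: F'_def fun_eq_iff)
  have "is_lift (F \<circ> F') id" using is_lift_compose[OF F F'] h by simp
  then obtain l where l: "\<And>v. (F \<circ> F') v = id v + l"
    using lifts_differ_by_int_vec[OF is_lift_id] by metis
  have "F 0 = (F \<circ> F') (F 0)" using left by (simp add: fun_eq_iff)
  then have "l = 0" using l[of "F 0"] by simp
  then have "F \<circ> F' = id" using l by (auto simp: fun_eq_iff)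
  then show thesis using that F' left by blast
qed

text \<open>The whole isotopy is lifted over the convex strip \<open>?S\<close>. Its increments
  under an integer translation are integral and continuous, hence constant in time, and at time 0
  they are those of a lift of the identity.\<close>

lemma linear_part_isotopic_to_id:
  assumes "isotopic_to_id \<phi>"
  shows "linear_part \<phi> (mat 1)"
proof -
  obtain h where h: "continuous_map (prod_topology (top_of_set {0..1}) euclidean) euclidean h"
    "\<And>x. h (0 :: real, x) = x" "\<And>x. h (1, x) = \<phi> x"
    using assms unfolding isotopic_to_id_def homotopic_with_def by auto
  let ?S = "{0..1::real} \<times> (UNIV :: (real ^ 2) set)"
  have "prod_topology (top_of_set {0..1::real}) (euclidean :: torus topology) = top_of_set ({0..1} \<times> UNIV)"
    using subtopology_Times[of euclidean "euclidean :: torus topology" "{0..1::real}" UNIV]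
    by simp
  then have "continuous_on ({0..1} \<times> UNIV) h" using h(1) by simp
  moreover have "continuous_on ?S (\<lambda>p. proj (snd p))"
    by (rule continuous_on_compose2[OF continuous_proj continuous_on_snd[OF continuous_on_id]]) simp
  ultimately have cont: "continuous_on ?S (\<lambda>p. h (fst p, proj (snd p)))"
    by (rule continuous_on_compose2[OF _ continuous_on_Pair[OF continuous_on_fst[OF continuous_on_id]]]) auto
  have cS: "convex ?S" by (intro convex_Times convex_real_interval convex_UNIV)
  obtain F where F: "continuous_on ?S F" "\<And>p. p \<in> ?S \<Longrightarrow> proj (F p) = h (fst p, proj (snd p))"
    using lift_to_plane[OF convex_imp_contractible[OF cS] cont] by blast
  have lift: "is_lift (\<lambda>v. F (t, v)) (\<lambda>x. h (t, x))" if "t \<in> {0..1}" for t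
  proof -
    have "continuous_on UNIV (\<lambda>v. F (t, v))"
      by (rule continuous_on_compose2[OF F(1) continuous_on_Pair[OF continuous_on_const continuous_on_id]])
        (use that in auto)
    then show ?thesis using that F(2) by (simp add: is_lift_def)
  qed
  have "equivariant (\<lambda>v. F (0, v)) (mat 1)"
    by (rule equivariant_lift[OF linear_part_id]) (use lift[of 0] h(2) in \<open>simp add: id_def\<close>)
  then have F0: "F (0, v + k) - F (0, v) = k" if "int_vec k" for v k
    using that equivariant_mat_1D[of "\<lambda>v. F (0, v)" k v] by simp
  have "F (1, v + k) = F (1, v) + k" if k: "int_vec k" for v k
  proof -
    let ?D = "\<lambda>p. F (fst p, snd p + k) - F p"
    have "?D (1, v) = ?D (0, v)"
    proof (rule int_vec_valued_constant[of ?S])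
      show "connected ?S" using cS by (rule convex_connected)
      show "continuous_on ?S ?D"
      proof (rule continuous_on_diff[OF _ F(1)])
        show "continuous_on ?S (\<lambda>p. F (fst p, snd p + k))"
          by (rule continuous_on_compose2[OF F(1)]) (auto intro!: continuous_intros)
      qed
      show "int_vec (?D p)" if "p \<in> ?S" for p
        using that k F(2)[of p] F(2)[of "(fst p, snd p + k)"]
        by (auto simp: proj_add_int_vec mem_Times_iff simp flip: proj_eq_iff)
    qed auto
    then show ?thesis using F0[OF k, of v] by (simp add: algebra_simps)
  qed
  then have "equivariant (\<lambda>v. F (1, v)) (mat 1)" by (simp add: equivariant_def)
  moreover have "is_lift (\<lambda>v. F (1, v)) \<phi>" using lift[of 1] h(3) by simp
  ultimately show ?thesis unfolding linear_part_def using int_mat_1 by blast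
qed

section \<open>Rotation vectors of states\<close>

definition push :: "('a \<Rightarrow> 'a) \<Rightarrow> (('a \<Rightarrow> real) \<Rightarrow> real) \<Rightarrow> ('a \<Rightarrow> real) \<Rightarrow> real" where
  "push g L f = L (f \<circ> g)"

lemma push_push: "push g (push h L) = push (g \<circ> h) L"
  by (simp add: push_def fun_eq_iff comp_assoc)

lemma push_id [simp]: "push id L = L"
  by (simp add: push_def fun_eq_iff)

abbreviation finv :: "('a \<Rightarrow> 'b) \<Rightarrow> 'b \<Rightarrow> 'a" where
  "finv \<equiv> inv_into UNIV"

definition homeo :: "(torus \<Rightarrow> torus) \<Rightarrow> bool" where
  "homeo g \<longleftrightarrow> bij g \<and> continuous_on UNIV g \<and> continuous_on UNIV (finv g)"

lemma homeo_cancel: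
  assumes "homeo g"
  shows "g \<circ> finv g = id" "finv g \<circ> g = id" "g (finv g x) = x" "finv g (g x) = x"
proof -
  have "bij g" using assms by (simp add: homeo_def)
  then show "g (finv g x) = x" "finv g (g x) = x" for x
    by (simp_all add: bij_is_surj surj_f_inv_f bij_is_inj)
  then show "g \<circ> finv g = id" "finv g \<circ> g = id" by (auto simp: fun_eq_iff)
qed

lemma homeo_inv: "homeo g \<Longrightarrow> homeo (finv g)"
  by (simp add: homeo_def bij_imp_bij_inv inv_inv_eq)

lemma homeo_continuous: "homeo g \<Longrightarrow> continuous_on UNIV g"
  by (simp add: homeo_def)

lemma homeo_compose:
  assumes "homeo g" "homeo h"
  shows "homeo (g \<circ> h)"
  unfolding homeo_def
proof (intro conjI)
  show "continuous_on UNIV (g \<circ> h)"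
    using assms unfolding homeo_def by (intro continuous_on_compose) (auto intro: continuous_on_subset)
  have "continuous_on UNIV (finv h \<circ> finv g)"
    using assms unfolding homeo_def by (intro continuous_on_compose) (auto intro: continuous_on_subset)
  then show "continuous_on UNIV (finv (g \<circ> h))"
    using assms by (simp add: homeo_def o_inv_distrib)
qed (use assms in \<open>simp add: homeo_def bij_comp\<close>)

lemma carrier_Homeo_T2: "carrier Homeo_T2 = {g. homeo g}"
proof (intro equalityI subsetI)
  fix g assume "g \<in> carrier Homeo_T2"
  then obtain h where h: "continuous_on UNIV g" "continuous_on UNIV h" "\<And>x. h (g x) = x" "\<And>x. g (h x) = x"
    by (auto simp: Homeo_T2_def homeomorphic_map_maps homeomorphic_maps_def)
  then have "bij g" by (intro o_bij[of h]) (auto simp: fun_eq_iff)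
  moreover have "finv g = h" using h by (intro inv_unique_comp) (auto simp: fun_eq_iff)
  ultimately show "g \<in> {g. homeo g}" using h by (simp add: homeo_def)
next
  fix g assume "g \<in> {g. homeo g}"
  then have g: "homeo g" by simp
  then show "g \<in> carrier Homeo_T2"
    unfolding Homeo_T2_def homeomorphic_map_maps homeomorphic_maps_def
    by (auto simp: homeo_def homeo_cancel[OF g] intro!: exI[of _ "finv g"])
qed

text \<open>Both directions matter: a pushed state must still vanish on discontinuous
  functions.\<close>

lemma continuous_comp_homeo_iff:
  assumes "homeo g"
  shows "continuous_on UNIV (f \<circ> g) \<longleftrightarrow> continuous_on UNIV f"
proof
  assume "continuous_on UNIV f"
  then show "continuous_on UNIV (f \<circ> g)"
    by (intro continuous_on_compose homeo_continuous[OF assms]) (auto intro: continuous_on_subset)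
next
  assume "continuous_on UNIV (f \<circ> g)"
  then have "continuous_on UNIV (\<lambda>x. (f \<circ> g) (finv g x))"
    by (rule continuous_on_compose2[OF _ homeo_continuous[OF homeo_inv[OF assms]]]) simp
  then show "continuous_on UNIV f" by (simp add: homeo_cancel[OF assms])
qed

lemma state_push:
  assumes L: "state L" and g: "homeo g"
  shows "state (push g L)"
proof -
  have c: "continuous_on UNIV (\<lambda>x. f (g x)) \<longleftrightarrow> continuous_on UNIV f" for f :: "torus \<Rightarrow> real"
    using continuous_comp_homeo_iff[OF g, of f] by (simp add: o_def)
  show ?thesis using L unfolding state_def push_def o_def by (simp add: c)
qed

section \<open>Displacements and rotation vectors\<close>

text \<open>The choice of representatives may be discontinuous, but equivariance removes it from the
  displacement, whose pullback to the plane is \<open>F v - v\<close>.\<close>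

lemma continuous_displacement:
  assumes "continuous_on UNIV F" "equivariant F (mat 1)"
  shows "continuous_on UNIV (\<lambda>x. displacement F x $ i)"
proof -
  have "displacement F (proj v) = F v - v" for v
    using equivariant_mat_1D[OF assms(2)] by (intro displacement_proj) (simp add: int_vec_def)
  then show ?thesis
    unfolding continuous_on_torus_iff using assms(1) by (simp add: continuous_intros)
qed

lemma displacement_proj_equivariant:
  "equivariant F (mat 1) \<Longrightarrow> displacement F (proj v) = F v - v"
  by (intro displacement_proj equivariant_mat_1D) (simp_all add: int_vec_def)

lemma displacement_bounded:
  assumes "continuous_on UNIV F" "equivariant F (mat 1)"
  obtains B where "0 \<le> B" "\<And>x i. \<bar>displacement F x $ i\<bar> \<le> B"
proof -
  have "\<exists>c. \<forall>x. \<bar>displacement F x $ i\<bar> \<le> c" for i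
    using compact_imp_bounded[OF compact_continuous_image[OF continuous_displacement[OF assms] compact_torus]]
    by (auto simp: bounded_iff)
  then obtain c where c: "\<And>i x. \<bar>displacement F x $ i\<bar> \<le> c i" by metis
  \<comment> \<open>Here \<open>undefined\<close> stands for an arbitrary point of the
    torus.\<close>
  have "0 \<le> c i" for i using c[of undefined i] by linarith
  then have "\<bar>displacement F x $ i\<bar> \<le> c 1 + c 2" for x i
    using c[of x i] exhaust_2[of i] by (smt (verit))
  then show thesis using that[of "c 1 + c 2"] \<open>\<And>i. 0 \<le> c i\<close> by simp
qed

definition rot :: "((torus \<Rightarrow> real) \<Rightarrow> real) \<Rightarrow> (real ^ 2 \<Rightarrow> real ^ 2) \<Rightarrow> real ^ 2" where
  "rot L F = (\<chi> i. L (\<lambda>x. displacement F x $ i))"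

lemma rot_nth [simp]: "rot L F $ i = L (\<lambda>x. displacement F x $ i)"
  by (simp add: rot_def)

lemma is_liftD: "is_lift F g \<Longrightarrow> continuous_on UNIV F" "is_lift F g \<Longrightarrow> proj (F v) = g (proj v)"
  by (simp_all add: is_lift_def)

lemma ex_proj: "\<exists>v. x = proj v"
  using proj_rep_torus by metis

text \<open>Displacement is a cocycle: that of \<open>P \<circ> Q\<close> at \<open>x\<close> is
  that of \<open>P\<close> at \<open>q x\<close> plus that of \<open>Q\<close> at \<open>x\<close>.
  Invariance under \<open>q\<close> removes the shift of base point.\<close>

lemma rot_compose:
  assumes L: "state L" and P: "is_lift P p" "equivariant P (mat 1)" and Q: "is_lift Q q" "equivariant Q (mat 1)"
    and inv: "push q L = L"
  shows "rot L (P \<circ> Q) = rot L P + rot L Q"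
proof -
  have PQ: "equivariant (P \<circ> Q) (mat 1)" using equivariant_compose[OF P(2) Q(2)] by simp
  have disp: "displacement (P \<circ> Q) x = displacement P (q x) + displacement Q x" for x
  proof -
    obtain v where v: "x = proj v" using ex_proj by blast
    show ?thesis
      unfolding v is_liftD(2)[OF Q(1), symmetric]
      by (simp add: displacement_proj_equivariant P(2) Q(2) PQ)
  qed
  have cont: "continuous_on UNIV (\<lambda>x. displacement P (q x) $ i)" for i
  proof -
    have "continuous_on UNIV q"
    proof -
      have "continuous_on UNIV (\<lambda>v. proj (Q v))"
        by (rule continuous_on_compose2[OF continuous_proj is_liftD(1)[OF Q(1)]]) simp
      then show ?thesis by (simp add: continuous_on_torus_iff is_liftD(2)[OF Q(1)])
    qed
    then show ?thesis
      by (rule continuous_on_compose2[OF continuous_displacement[OF is_liftD(1)[OF P(1)] P(2)]]) simp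
  qed
  have "L (\<lambda>x. displacement P (q x) $ i) = L (\<lambda>x. displacement P x $ i)" for i
    using fun_cong[OF inv, of "\<lambda>x. displacement P x $ i"] by (simp add: push_def o_def)
  then show ?thesis
    using state_add[OF L cont continuous_displacement[OF is_liftD(1)[OF Q(1)] Q(2)]]
    by (simp add: vec_eq_iff disp)
qed

text \<open>Write \<open>F = A + p\<close> with \<open>p\<close> periodic; the two contributions of \<open>p\<close> cancel by invariance.\<close>

lemma rot_push:
  assumes L: "state L" and F: "is_lift F g" "equivariant F A"
    and P: "equivariant P (mat 1)" and X: "is_lift X q" "equivariant X (mat 1)"
    and PF: "P \<circ> F = F \<circ> X" and q: "homeo q" and inv: "push q L = L"
  shows "rot (push g L) P = A *v rot L X"
proof -
  define p where "p x = F (rep_torus x) - A *v rep_torus x" for x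
  have p_proj: "p (proj v) = F v - A *v v" for v
  proof -
    have k: "int_vec (rep_torus (proj v) - v)" by (simp flip: proj_eq_iff)
    have "F (rep_torus (proj v)) = F v + A *v (rep_torus (proj v) - v)"
      using equivariantD[OF F(2) k, of v] by simp
    then show ?thesis by (simp add: p_def matrix_vector_mult_diff_distrib)
  qed
  have cp: "continuous_on UNIV (\<lambda>x. p x $ i)" for i
    unfolding continuous_on_torus_iff p_proj
    by (intro continuous_intros is_liftD(1)[OF F(1)])
  have cpq: "continuous_on UNIV (\<lambda>x. p (q x) $ i)" for i
    by (rule continuous_on_compose2[OF cp homeo_continuous[OF q]]) simp
  \<comment> \<open>Both sides are \<open>F (X v) - F v\<close>, the left one through
    \<open>P \<circ> F = F \<circ> X\<close> and the right one through the decomposition of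
    \<open>F\<close>.\<close>
  have disp: "displacement P (g x) = A *v displacement X x + (p (q x) - p x)" for x
  proof -
    obtain v where v: "x = proj v" using ex_proj by blast
    have "P (F v) = F (X v)" using fun_cong[OF PF, of v] by simp
    then show ?thesis
      unfolding v is_liftD(2)[OF F(1), symmetric] is_liftD(2)[OF X(1), symmetric] p_proj
      by (simp add: displacement_proj_equivariant P X(2) p_proj matrix_vector_mult_diff_distrib)
  qed
  have cX: "continuous_on UNIV (\<lambda>x. displacement X x $ i)" for i
    by (rule continuous_displacement[OF is_liftD(1)[OF X(1)] X(2)])
  have "rot (push g L) P $ i = (A *v rot L X) $ i" for i
  proof -
    have "L (\<lambda>x. p (q x) $ i) = L (\<lambda>x. p x $ i)"
      using fun_cong[OF inv, of "\<lambda>x. p x $ i"] by (simp add: push_def o_def)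
    then have "L (\<lambda>x. p (q x) $ i - p x $ i) = 0"
      using state_diff[OF L cpq cp, of i i] by simp
    moreover have "L (\<lambda>x. A $ i $ 1 * displacement X x $ 1 + A $ i $ 2 * displacement X x $ 2)
        = A $ i $ 1 * L (\<lambda>x. displacement X x $ 1) + A $ i $ 2 * L (\<lambda>x. displacement X x $ 2)"
      by (subst state_add[OF L]) (simp_all add: state_scale[OF L cX] cX continuous_on_mult_left)
    moreover have "rot (push g L) P $ i
        = L (\<lambda>x. (A $ i $ 1 * displacement X x $ 1 + A $ i $ 2 * displacement X x $ 2) + (p (q x) $ i - p x $ i))"
      by (simp add: push_def o_def disp matrix_vector_mult_def sum_2)
    moreover have "\<dots> = L (\<lambda>x. A $ i $ 1 * displacement X x $ 1 + A $ i $ 2 * displacement X x $ 2)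
        + L (\<lambda>x. p (q x) $ i - p x $ i)"
      by (intro state_add[OF L] continuous_on_add continuous_on_mult_left continuous_on_diff cX cp cpq)
    ultimately show ?thesis by (simp add: matrix_vector_mult_def sum_2)
  qed
  then show ?thesis by (simp add: vec_eq_iff)
qed

lemma rot_bounded:
  assumes "is_lift P p" "equivariant P (mat 1)"
  obtains B where "\<And>L i. state L \<Longrightarrow> \<bar>rot L P $ i\<bar> \<le> B"
proof -
  obtain B where "0 \<le> B" "\<And>x i. \<bar>displacement P x $ i\<bar> \<le> B"
    using displacement_bounded[OF is_liftD(1)[OF assms(1)] assms(2)] by blast
  then show thesis using that[of B] state_abs_le by (metis rot_nth)
qed

section \<open>Rigidity of bounded affine orbits\<close>

lemma bounded_linear_growth_zero:
  fixes a b C :: real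
  assumes "\<And>n::nat. \<bar>a + real n * b\<bar> \<le> C"
  shows "b = 0"
proof (rule ccontr)
  assume "b \<noteq> 0"
  then obtain n where n: "C + \<bar>a\<bar> < real n * \<bar>b\<bar>" using reals_Archimedean3[of "\<bar>b\<bar>"] by auto
  have "real n * \<bar>b\<bar> = \<bar>real n * b\<bar>" by (simp add: abs_mult)
  then show False using assms[of n] n by linarith
qed

text \<open>The increments \<open>y = r \<circ> T - r\<close> satisfy \<open>y \<circ> T = A y\<close>, hence the recurrence
  \<open>y \<circ> T\<^sup>2 - t y \<circ> T + y = 0\<close>, whose only bounded two-sided solutions are constant for \<open>t = 2\<close> and
  zero for \<open>\<bar>t\<bar> > 2\<close>.\<close>

lemma affine_orbit_rigid:
  fixes A :: "real ^ 2 ^ 2" and r w :: "'q \<Rightarrow> real ^ 2"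
  assumes CH: "\<And>x. A *v (A *v x) = t *\<^sub>R (A *v x) - x" and t: "t = 2 \<or> 2 < \<bar>t\<bar>"
    and T: "T ` Q = Q" and bounded: "\<And>q i. q \<in> Q \<Longrightarrow> \<bar>r q $ i\<bar> \<le> B"
    and r: "\<And>q. q \<in> Q \<Longrightarrow> r (T q) = A *v (r q + w q)" and w: "\<And>q. q \<in> Q \<Longrightarrow> w (T q) = w q"
    and q: "q \<in> Q"
  shows "r (T q) = r q"
proof -
  have TQ: "T p \<in> Q" if "p \<in> Q" for p using T that by blast
  have iterQ: "(T ^^ n) p \<in> Q" if "p \<in> Q" for p n using that TQ by (induction n) auto
  define y where "y p = r (T p) - r p" for p
  have yT: "y (T p) = A *v y p" if p: "p \<in> Q" for p
  proof -
    have "y (T p) = A *v (r (T p) + w (T p)) - A *v (r p + w p)"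
      using r[OF p] r[OF TQ[OF p]] by (simp add: y_def)
    also have "\<dots> = A *v ((r (T p) + w (T p)) - (r p + w p))"
      by (simp add: matrix_vector_mult_diff_distrib)
    also have "(r (T p) + w (T p)) - (r p + w p) = y p" using w[OF p] by (simp add: y_def)
    finally show ?thesis .
  qed
  have rec: "y (T (T p)) = t *\<^sub>R y (T p) - y p" if p: "p \<in> Q" for p
    using CH[of "y p"] yT[OF p] yT[OF TQ[OF p]] by simp
  have y_bound: "\<bar>y p $ i\<bar> \<le> 2 * B" if "p \<in> Q" for p i
    using bounded[OF that, of i] bounded[OF TQ[OF that], of i] by (simp add: y_def)
  have "y q $ i = 0" for i
  proof (cases "t = 2")
    case True
    \<comment> \<open>For \<open>t = 2\<close> second differences of \<open>y\<close> along the
      orbit vanish, so \<open>y\<close> grows linearly with slope \<open>z\<close>, which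
      boundedness forces to be 0. Then \<open>r\<close> grows linearly with slope
      \<open>y q\<close>, which must vanish too.\<close>
    define z where "z = y (T q) - y q"
    have lin: "y ((T ^^ n) q) = y q + real n *\<^sub>R z \<and> y ((T ^^ Suc n) q) = y q + real (Suc n) *\<^sub>R z" for n
    proof (induction n)
      case (Suc n)
      have "y ((T ^^ Suc (Suc n)) q) = 2 *\<^sub>R y ((T ^^ Suc n) q) - y ((T ^^ n) q)"
        using rec[OF iterQ[OF q, of n]] True by simp
      also have "\<dots> = 2 *\<^sub>R (y q + real (Suc n) *\<^sub>R z) - (y q + real n *\<^sub>R z)" using Suc by simp
      also have "\<dots> = y q + real (Suc (Suc n)) *\<^sub>R z" by (simp add: vec_eq_iff algebra_simps)
      finally show ?case using Suc by blast
    qed (simp add: z_def)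
    have "\<bar>y q $ i + real n * z $ i\<bar> \<le> 2 * B" for n
      using y_bound[OF iterQ[OF q, of n], of i] lin[of n] by simp
    then have "z $ i = 0" by (rule bounded_linear_growth_zero)
    then have const: "y ((T ^^ n) q) $ i = y q $ i" for n using lin[of n] by simp
    have "r ((T ^^ n) q) $ i = r q $ i + real n * y q $ i" for n
    proof (induction n)
      case (Suc n)
      have "r ((T ^^ Suc n) q) $ i = r ((T ^^ n) q) $ i + y ((T ^^ n) q) $ i" by (simp add: y_def)
      then show ?case using Suc const by (simp add: algebra_simps)
    qed simp
    then have "\<bar>r q $ i + real n * y q $ i\<bar> \<le> B" for n
      using bounded[OF iterQ[OF q, of n], of i] by simp
    then show ?thesis by (rule bounded_linear_growth_zero)
  next
    case False
    then have t2: "2 < \<bar>t\<bar>" using t by simp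
    \<comment> \<open>The recurrence bounds the middle of three consecutive terms by its neighbours,
      gaining a factor \<open>2 / \<bar>t\<bar>\<close> less than 1 each time. The earlier neighbour
      comes from surjectivity of \<open>T\<close> on \<open>Q\<close>, which is where two-sidedness
      of orbits enters.\<close>
    have decay: "\<bar>y p $ i\<bar> \<le> 2 * B * (2 / \<bar>t\<bar>) ^ n" if "p \<in> Q" for p n
      using that
    proof (induction n arbitrary: p)
      case (Suc n)
      then obtain p' where p': "p' \<in> Q" "p = T p'" using T by blast
      have "t * y p $ i = y (T p) $ i + y p' $ i"
        using arg_cong[OF rec[OF p'(1)], of "\<lambda>v. v $ i"] p' by simp
      then have "\<bar>t\<bar> * \<bar>y p $ i\<bar> \<le> \<bar>y (T p) $ i\<bar> + \<bar>y p' $ i\<bar>"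
        by (metis abs_mult abs_triangle_ineq)
      also have "\<dots> \<le> 2 * (2 * B * (2 / \<bar>t\<bar>) ^ n)"
        using Suc.IH[OF p'(1)] Suc.IH[OF TQ[OF Suc.prems]] by simp
      finally show ?case using t2 by (simp add: field_simps)
    qed (use y_bound in simp)
    have "(\<lambda>n. 2 * B * (2 / \<bar>t\<bar>) ^ n) \<longlonglongrightarrow> 2 * B * 0"
      using t2 by (intro tendsto_mult tendsto_const LIMSEQ_realpow_zero) auto
    then have "\<bar>y q $ i\<bar> \<le> 2 * B * 0"
      by (rule LIMSEQ_le_const) (use decay[OF q] in auto)
    then show ?thesis by simp
  qed
  then show ?thesis by (simp add: y_def vec_eq_iff)
qed

section \<open>The congruence condition modulo 3\<close>

definition level3 :: "real ^ 2 ^ 2 \<Rightarrow> bool" where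
  "level3 A \<longleftrightarrow> (\<exists>C. int_mat C \<and> A = mat 1 + 3 *\<^sub>R C)"

lemma cayley_hamilton_2:
  fixes A :: "real ^ 2 ^ 2"
  shows "A *v (A *v x) = (A $ 1 $ 1 + A $ 2 $ 2) *\<^sub>R (A *v x) - det A *\<^sub>R x"
  by (simp add: vec_eq_iff forall_2 matrix_vector_mult_def sum_2 det_2 algebra_simps)

text \<open>The determinant is a unit congruent to 1 modulo 3, hence 1. Expanding it gives
  \<open>s = - 3 * d\<close>, so the trace \<open>2 + 3 * s\<close> is \<open>2 - 9 * d\<close>:
  either 2 or of modulus at least 7.\<close>

lemma level3_trace:
  assumes A: "level3 A" and B: "int_mat B" "A ** B = mat 1"
  obtains t where "\<And>x. A *v (A *v x) = t *\<^sub>R (A *v x) - x" "t = 2 \<or> 2 < \<bar>t\<bar>"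
proof -
  obtain C where C: "int_mat C" "A = mat 1 + 3 *\<^sub>R C" using A by (auto simp: level3_def)
  obtain c where c: "\<And>i j. C $ i $ j = of_int (c i j)"
    using C(1) unfolding int_mat_def Ints_def image_iff by metis
  obtain b where b: "\<And>i j. B $ i $ j = of_int (b i j)"
    using B(1) unfolding int_mat_def Ints_def image_iff by metis
  define s where "s = c 1 1 + c 2 2"
  define d where "d = c 1 1 * c 2 2 - c 1 2 * c 2 1"
  define e where "e = b 1 1 * b 2 2 - b 1 2 * b 2 1"
  have detA: "det A = of_int (1 + 3 * s + 9 * d)"
    by (simp add: det_2 C(2) c mat_def s_def d_def algebra_simps)
  have detB: "det B = of_int e" by (simp add: det_2 b e_def)
  have "det A * det B = 1" using B(2) by (metis det_mul det_I)
  then have "real_of_int ((1 + 3 * s + 9 * d) * e) = 1" by (simp add: detA detB)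
  then have "(1 + 3 * s + 9 * d) * e = 1" by linarith
  then have "1 + 3 * s + 9 * d = 1 \<or> 1 + 3 * s + 9 * d = -1" by (auto simp: zmult_eq_1_iff)
  then have s: "s = - 3 * d" by presburger
  have tr: "A $ 1 $ 1 + A $ 2 $ 2 = of_int (2 - 9 * d)"
    using s by (simp add: C(2) c mat_def s_def)
  have "det A = 1" using detA s by simp
  show thesis
  proof (rule that)
    show "A *v (A *v x) = of_int (2 - 9 * d) *\<^sub>R (A *v x) - x" for x
      using cayley_hamilton_2[of A x] tr \<open>det A = 1\<close> by simp
    have "2 - 9 * d = 2 \<or> 2 < \<bar>2 - 9 * d\<bar>" by presburger
    then show "real_of_int (2 - 9 * d) = 2 \<or> 2 < \<bar>real_of_int (2 - 9 * d)\<bar>" by linarith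
  qed
qed

lemma linear_part_inv:
  assumes g: "homeo g" and A: "linear_part g A"
  obtains B where "linear_part (finv g) B" "A ** B = mat 1" "B ** A = mat 1"
proof -
  obtain B where B: "linear_part (finv g) B"
    using ex_linear_part[OF homeo_continuous[OF homeo_inv[OF g]]] by blast
  have "A ** B = mat 1" "B ** A = mat 1"
    using linear_part_unique[OF linear_part_compose[OF A B]] linear_part_unique[OF linear_part_compose[OF B A]]
      linear_part_id homeo_cancel[OF g] by simp_all
  then show thesis using that B by blast
qed

text \<open>Since \<open>finv g \<circ> \<psi> \<circ> g = \<psi> \<circ> d\<close>, the rotation
  vector of \<open>\<Psi>\<close> changes under \<open>push g\<close> by
  \<open>x \<mapsto> A *v (x + w)\<close>, where \<open>w\<close> is the rotation vector of a lift
  of \<open>d\<close> and is constant along orbits by \<open>d_rot\<close>. Closure of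
  \<open>Q\<close> under \<open>push g\<close> and its inverse makes the orbits two-sided, so
  \<open>affine_orbit_rigid\<close> applies.\<close>

lemma rot_push_eq_rot:
  assumes Q: "\<And>L. L \<in> Q \<Longrightarrow> state L" "\<And>L. L \<in> Q \<Longrightarrow> push g L \<in> Q" "\<And>L. L \<in> Q \<Longrightarrow> push (finv g) L \<in> Q"
    and g: "homeo g" "linear_part g A" "level3 A"
    and \<psi>: "homeo \<psi>" "linear_part \<psi> (mat 1)" "is_lift \<Psi> \<psi>"
    and d: "d = finv \<psi> \<circ> finv g \<circ> \<psi> \<circ> g"
    and inv: "\<And>L. L \<in> Q \<Longrightarrow> push \<psi> L = L" "\<And>L. L \<in> Q \<Longrightarrow> push d L = L"
    and d_rot: "\<And>D L. is_lift D d \<Longrightarrow> L \<in> Q \<Longrightarrow> rot (push g L) D = rot L D"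
    and L: "L \<in> Q"
  shows "rot (push g L) \<Psi> = rot L \<Psi>"
proof -
  obtain F where F: "is_lift F g" "equivariant F A" using g(2) by (auto simp: linear_part_def)
  obtain F' where F': "is_lift F' (finv g)" "F' \<circ> F = id" "F \<circ> F' = id"
    using inverse_lift[OF F(1)] homeo_continuous[OF homeo_inv[OF g(1)]] homeo_cancel[OF g(1)] by metis
  obtain \<Psi>' where \<Psi>': "is_lift \<Psi>' (finv \<psi>)" "\<Psi>' \<circ> \<Psi> = id" "\<Psi> \<circ> \<Psi>' = id"
    using inverse_lift[OF \<psi>(3)] homeo_continuous[OF homeo_inv[OF \<psi>(1)]] homeo_cancel[OF \<psi>(1)] by metis
  obtain B where B: "linear_part (finv g) B" "A ** B = mat 1" "B ** A = mat 1"
    using linear_part_inv[OF g(1,2)] .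
  obtain B' where "linear_part (finv \<psi>) B'" "mat 1 ** B' = mat 1"
    using linear_part_inv[OF \<psi>(1,2)] by metis
  then have \<psi>'1: "linear_part (finv \<psi>) (mat 1)" by simp
  \<comment> \<open>These lifts of \<open>finv g \<circ> \<psi> \<circ> g\<close> and of
    \<open>d\<close> are tied together, so that \<open>X = \<Psi> \<circ> D\<close> and
    \<open>\<Psi> \<circ> F = F \<circ> X\<close> hold exactly and not just up to an integer
    vector.\<close>
  define X where "X = F' \<circ> \<Psi> \<circ> F"
  define D where "D = \<Psi>' \<circ> X"
  define q where "q = finv g \<circ> \<psi> \<circ> g"
  have X: "is_lift X q" unfolding X_def q_def by (intro is_lift_compose F F' \<psi>)
  have q1: "linear_part q (mat 1)"
    using linear_part_compose[OF linear_part_compose[OF B(1) \<psi>(2)] g(2)] B(3) by (simp add: q_def)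
  have D: "is_lift D d" unfolding D_def d
    using is_lift_compose[OF \<Psi>'(1) X] by (simp add: q_def comp_assoc)
  have d1: "linear_part d (mat 1)"
    using linear_part_compose[OF \<psi>'1 q1] by (simp add: d q_def comp_assoc)
  have XD: "X = \<Psi> \<circ> D" unfolding D_def using \<Psi>'(3) by (simp flip: comp_assoc)
  have \<Psi>F: "\<Psi> \<circ> F = F \<circ> X" unfolding X_def using F'(3) by (simp flip: comp_assoc)
  have q_eq: "q = \<psi> \<circ> d" unfolding d q_def using homeo_cancel(1)[OF \<psi>(1)] by (simp flip: comp_assoc)
  have hq: "homeo q" unfolding q_def by (intro homeo_compose homeo_inv g \<psi>)
  have e\<Psi>: "equivariant \<Psi> (mat 1)" by (rule equivariant_lift[OF \<psi>(2,3)])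
  have eX: "equivariant X (mat 1)" by (rule equivariant_lift[OF q1 X])
  have eD: "equivariant D (mat 1)" by (rule equivariant_lift[OF d1 D])
  obtain bnd where bnd: "\<And>L i. state L \<Longrightarrow> \<bar>rot L \<Psi> $ i\<bar> \<le> bnd"
    using rot_bounded[OF \<psi>(3) e\<Psi>] by blast
  obtain t where t: "\<And>x. A *v (A *v x) = t *\<^sub>R (A *v x) - x" "t = 2 \<or> 2 < \<bar>t\<bar>"
    using level3_trace[OF g(3) linear_part_int_mat[OF B(1)] B(2)] by blast
  show ?thesis
  proof (rule affine_orbit_rigid[where T = "push g" and r = "\<lambda>L. rot L \<Psi>" and w = "\<lambda>L. rot L D" and Q = Q, OF t])
    show "push g ` Q = Q"
    proof
      show "Q \<subseteq> push g ` Q"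
      proof
        fix L assume "L \<in> Q"
        moreover have "L = push g (push (finv g) L)" by (simp add: push_push homeo_cancel[OF g(1)])
        ultimately show "L \<in> push g ` Q" using Q(3) by blast
      qed
    qed (use Q(2) in blast)
    show "\<bar>rot L \<Psi> $ i\<bar> \<le> bnd" if "L \<in> Q" for L i using bnd Q(1)[OF that] by blast
    show "rot (push g L) \<Psi> = A *v (rot L \<Psi> + rot L D)" if LQ: "L \<in> Q" for L
    proof -
      have "push q L = L" using inv[OF LQ] by (simp add: q_eq flip: push_push)
      then have "rot (push g L) \<Psi> = A *v rot L X"
        by (rule rot_push[OF Q(1)[OF LQ] F e\<Psi> X eX \<Psi>F hq])
      also have "rot L X = rot L \<Psi> + rot L D"
        unfolding XD by (rule rot_compose[OF Q(1)[OF LQ] \<psi>(3) e\<Psi> D eD inv(2)[OF LQ]])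
      finally show ?thesis .
    qed
    show "rot (push g L) D = rot L D" if "L \<in> Q" for L by (rule d_rot[OF D that])
    show "L \<in> Q" by (rule L)
  qed
qed

section \<open>Invariant measures for central filtrations\<close>

lemma linear_part_commutator:
  assumes g: "homeo g" "linear_part g A" and \<psi>: "homeo \<psi>" "linear_part \<psi> (mat 1)"
  shows "linear_part (finv \<psi> \<circ> finv g \<circ> \<psi> \<circ> g) (mat 1)"
proof -
  obtain B where B: "linear_part (finv g) B" "B ** A = mat 1" using linear_part_inv[OF g] .
  obtain B' where "linear_part (finv \<psi>) B'" "mat 1 ** B' = mat 1" using linear_part_inv[OF \<psi>] .
  then have "linear_part (finv \<psi>) (mat 1)" by simp
  from linear_part_compose[OF linear_part_compose[OF linear_part_compose[OF this B(1)] \<psi>(2)] g(2)]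
  show ?thesis using B(2) by simp
qed

text \<open>Models the lower central series cut down to \<open>H\<close>, trivial at index
  \<open>n\<close>. Commutators have the inverses first, the form that conjugation by
  \<open>finv\<close> produces.\<close>

locale central_filtration =
  fixes H :: "(torus \<Rightarrow> torus) set" and \<Gamma> :: "nat \<Rightarrow> (torus \<Rightarrow> torus) set" and n :: nat
  assumes homeo: "g \<in> H \<Longrightarrow> homeo g"
    and level3: "g \<in> H \<Longrightarrow> \<exists>A. linear_part g A \<and> level3 A"
    and inv_closed: "g \<in> \<Gamma> j \<Longrightarrow> finv g \<in> \<Gamma> j"
    and comp_closed: "g \<in> \<Gamma> j \<Longrightarrow> h \<in> \<Gamma> j \<Longrightarrow> g \<circ> h \<in> \<Gamma> j"
    and antimono: "j \<le> m \<Longrightarrow> \<Gamma> m \<subseteq> \<Gamma> j"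
    and commutator_closed: "g \<in> \<Gamma> j \<Longrightarrow> h \<in> H \<Longrightarrow> finv g \<circ> finv h \<circ> g \<circ> h \<in> \<Gamma> (Suc j)"
    and first: "\<Gamma> 0 = H" and last: "\<Gamma> n = {id}"
begin

lemma subset: "g \<in> \<Gamma> j \<Longrightarrow> g \<in> H"
  using antimono[of 0 j] first by auto

text \<open>The inverse of a commutator is the commutator in the opposite order.\<close>

lemma commutator_closed':
  assumes "g \<in> \<Gamma> j" "h \<in> H"
  shows "finv h \<circ> finv g \<circ> h \<circ> g \<in> \<Gamma> (Suc j)"
proof -
  have g: "bij g" and h: "bij h" using homeo subset assms by (auto simp: homeo_def)
  have "finv (finv g \<circ> finv h \<circ> g \<circ> h) = finv h \<circ> finv g \<circ> h \<circ> g"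
    using g h by (simp add: o_inv_distrib bij_imp_bij_inv bij_comp inv_inv_eq comp_assoc)
  then show ?thesis using inv_closed[OF commutator_closed[OF assms]] by simp
qed

lemma conjugate_closed:
  assumes "g \<in> \<Gamma> j" "h \<in> H"
  shows "finv h \<circ> g \<circ> h \<in> \<Gamma> j"
proof -
  have "finv h \<circ> g \<circ> h = g \<circ> (finv g \<circ> finv h \<circ> g \<circ> h)"
    using homeo_cancel[OF homeo[OF subset[OF assms(1)]]] by (simp add: fun_eq_iff)
  moreover have "finv g \<circ> finv h \<circ> g \<circ> h \<in> \<Gamma> j"
    using commutator_closed[OF assms] antimono[of j "Suc j"] by auto
  ultimately show ?thesis using comp_closed[OF assms(1)] by simp
qed

text \<open>These sets interpolate between invariance under \<open>\<phi>\<close> alone, at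
  \<open>j = n\<close>, and, for \<open>\<phi> \<in> H\<close>, invariance under all of
  \<open>H\<close>, at \<open>j = 0\<close>.\<close>

definition inv_states :: "(torus \<Rightarrow> torus) \<Rightarrow> nat \<Rightarrow> ((torus \<Rightarrow> real) \<Rightarrow> real) set" where
  "inv_states \<phi> j = {L. state L \<and> push \<phi> L = L \<and> (\<forall>\<gamma>\<in>\<Gamma> j. push \<gamma> L = L)}"

text \<open>Conjugation by \<open>g\<close> preserves \<open>\<Gamma> (Suc j)\<close> and changes
  \<open>\<phi>\<close> by a commutator lying in it, so the pushed state keeps all its
  invariances.\<close>

lemma push_inv_states:
  assumes \<phi>: "\<phi> \<in> H" and g: "g \<in> \<Gamma> j" and L: "L \<in> inv_states \<phi> (Suc j)"
  shows "push g L \<in> inv_states \<phi> (Suc j)"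
proof -
  have gH: "g \<in> H" and hg: "homeo g" using g subset homeo by auto
  have L': "state L" "push \<phi> L = L" "\<And>\<gamma>. \<gamma> \<in> \<Gamma> (Suc j) \<Longrightarrow> push \<gamma> L = L"
    using L by (auto simp: inv_states_def)
  have "push \<gamma> (push g L) = push g L" if \<gamma>: "\<gamma> \<in> \<Gamma> (Suc j)" for \<gamma>
  proof -
    have "\<gamma> \<circ> g = g \<circ> (finv g \<circ> \<gamma> \<circ> g)"
      using homeo_cancel[OF hg] by (simp add: fun_eq_iff)
    then have "push \<gamma> (push g L) = push g (push (finv g \<circ> \<gamma> \<circ> g) L)"
      by (simp add: push_push)
    then show ?thesis using L'(3)[OF conjugate_closed[OF \<gamma> gH]] by simp
  qed
  moreover have "push \<phi> (push g L) = push g L"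
  proof -
    have "\<phi> \<circ> g = g \<circ> (\<phi> \<circ> (finv \<phi> \<circ> finv g \<circ> \<phi> \<circ> g))"
      using homeo_cancel[OF hg] homeo_cancel[OF homeo[OF \<phi>]] by (simp add: fun_eq_iff)
    then have "push \<phi> (push g L) = push g (push \<phi> (push (finv \<phi> \<circ> finv g \<circ> \<phi> \<circ> g) L))"
      by (simp add: push_push)
    then show ?thesis using L'(2) L'(3)[OF commutator_closed'[OF g \<phi>]] by simp
  qed
  ultimately show ?thesis using state_push[OF L'(1) hg] by (simp add: inv_states_def)
qed

text \<open>The step shared by \<open>\<phi>\<close> itself, which need not lie in
  \<open>\<Gamma> (Suc j)\<close>, and by the elements of deeper terms: the commutator with
  \<open>g\<close> lies in \<open>\<Gamma> m\<close>, where rotation vectors are already known to be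
  unchanged by \<open>push g\<close>.\<close>

lemma rot_push_inv_states_step:
  assumes \<phi>: "\<phi> \<in> H" and g: "g \<in> \<Gamma> j" and L: "L \<in> inv_states \<phi> (Suc j)"
    and \<psi>: "\<psi> \<in> H" "linear_part \<psi> (mat 1)" "is_lift \<Psi> \<psi>"
    and inv: "\<And>L. L \<in> inv_states \<phi> (Suc j) \<Longrightarrow> push \<psi> L = L"
    and d: "finv \<psi> \<circ> finv g \<circ> \<psi> \<circ> g \<in> \<Gamma> m" "Suc j \<le> m"
    and IH: "\<And>\<psi>' \<Psi>' L. \<psi>' \<in> \<Gamma> m \<Longrightarrow> linear_part \<psi>' (mat 1) \<Longrightarrow> is_lift \<Psi>' \<psi>' \<Longrightarrow>
      L \<in> inv_states \<phi> (Suc j) \<Longrightarrow> rot (push g L) \<Psi>' = rot L \<Psi>'"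
  shows "rot (push g L) \<Psi> = rot L \<Psi>"
proof -
  have gH: "g \<in> H" using g subset by auto
  obtain A where A: "linear_part g A" "level3 A" using level3[OF gH] by blast
  note hg = homeo[OF gH] and h\<psi> = homeo[OF \<psi>(1)]
  show ?thesis
  proof (rule rot_push_eq_rot[OF _ _ _ hg A h\<psi> \<psi>(2,3) refl inv _ _ L])
    fix L assume L: "L \<in> inv_states \<phi> (Suc j)"
    show "state L" using L by (simp add: inv_states_def)
    show "push g L \<in> inv_states \<phi> (Suc j)" "push (finv g) L \<in> inv_states \<phi> (Suc j)"
      using push_inv_states[OF \<phi> g L] push_inv_states[OF \<phi> inv_closed[OF g] L] .
    show "push (finv \<psi> \<circ> finv g \<circ> \<psi> \<circ> g) L = L"
      using L d antimono[OF d(2)] by (auto simp: inv_states_def)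
    show "rot (push g L) D = rot L D" if "is_lift D (finv \<psi> \<circ> finv g \<circ> \<psi> \<circ> g)" for D
      by (rule IH[OF d(1) linear_part_commutator[OF hg A(1) h\<psi> \<psi>(2)] that L])
  qed
qed

text \<open>Descending induction on \<open>m\<close> from \<open>n\<close>. At the bottom
  \<open>\<psi>\<close> is the identity, its lifts are translations, and every state gives the
  translation vector.\<close>

lemma rot_push_inv_states_deep:
  assumes \<phi>: "\<phi> \<in> H" and g: "g \<in> \<Gamma> j" and m: "Suc j \<le> m" "m \<le> n"
    and "\<psi> \<in> \<Gamma> m" "linear_part \<psi> (mat 1)" "is_lift \<Psi> \<psi>" "L \<in> inv_states \<phi> (Suc j)"
  shows "rot (push g L) \<Psi> = rot L \<Psi>"
  using m(2,1) assms(5-8)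
proof (induction m arbitrary: \<psi> \<Psi> L rule: inc_induct)
  case base
  then have "\<psi> = id" using last by blast
  then have "is_lift \<Psi> id" using base by blast
  then obtain k where "\<And>v. \<Psi> v = id v + k"
    using lifts_differ_by_int_vec[OF is_lift_id] by metis
  then have "displacement \<Psi> x = k" for x by (simp add: displacement_def)
  moreover have "state L" "state (push g L)"
    using base(5) push_inv_states[OF \<phi> g base(5)] by (auto simp: inv_states_def)
  ultimately show ?case by (simp add: vec_eq_iff state_const)
next
  case (step m)
  show ?case
  proof (rule rot_push_inv_states_step[OF \<phi> g step.prems(5) subset[OF step.prems(2)] step.prems(3,4)])
    show "push \<psi> L = L" if "L \<in> inv_states \<phi> (Suc j)" for L
      using that step.prems(1,2) antimono[of "Suc j" m] by (auto simp: inv_states_def)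
    show "finv \<psi> \<circ> finv g \<circ> \<psi> \<circ> g \<in> \<Gamma> (Suc m)"
      by (rule commutator_closed[OF step.prems(2) subset[OF g]])
  qed (use step in auto)
qed

lemma rot_push_inv_states:
  assumes "\<phi> \<in> H" "linear_part \<phi> (mat 1)" "is_lift \<Phi> \<phi>" "g \<in> \<Gamma> j" "j < n" "L \<in> inv_states \<phi> (Suc j)"
  shows "rot (push g L) \<Phi> = rot L \<Phi>"
proof (rule rot_push_inv_states_step[OF assms(1,4,6) assms(1-3)])
  show "finv \<phi> \<circ> finv g \<circ> \<phi> \<circ> g \<in> \<Gamma> (Suc j)"
    by (rule commutator_closed'[OF assms(4,1)])
  show "rot (push g L) \<Psi>' = rot L \<Psi>'"
    if "\<psi>' \<in> \<Gamma> (Suc j)" "linear_part \<psi>' (mat 1)" "is_lift \<Psi>' \<psi>'" "L \<in> inv_states \<phi> (Suc j)" for \<psi>' \<Psi>' L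
    by (rule rot_push_inv_states_deep[OF assms(1,4) order_refl _ that]) (use assms(5) in simp)
qed (simp_all add: inv_states_def)

lemma compact_inv_states: "compact (inv_states \<phi> j \<inter> {L. rot L \<Phi> = r})"
proof -
  have "closed {L :: (torus \<Rightarrow> real) \<Rightarrow> real. push g L = L}" for g
  proof -
    have "{L. push g L = L} = {L. \<forall>f. L (f \<circ> g) = L f}" by (simp add: push_def fun_eq_iff)
    then show ?thesis
      by (simp add: closed_Collect_all closed_Collect_eq continuous_on_product_coordinates)
  qed
  moreover have "closed {L. rot L \<Phi> = r}"
    unfolding vec_eq_iff rot_nth
    by (intro closed_Collect_all closed_Collect_eq continuous_on_product_coordinates continuous_on_const)
  ultimately have "compact ({L. state L} \<inter> ({L. push \<phi> L = L} \<inter> (\<Inter>\<gamma>\<in>\<Gamma> j. {L. push \<gamma> L = L}) \<inter> {L. rot L \<Phi> = r}))"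
    by (intro compact_Int_closed compact_states compact_torus closed_Int closed_INT ballI)
  moreover have "{L. state L} \<inter> ({L. push \<phi> L = L} \<inter> (\<Inter>\<gamma>\<in>\<Gamma> j. {L. push \<gamma> L = L}) \<inter> {L. rot L \<Phi> = r})
      = inv_states \<phi> j \<inter> {L. rot L \<Phi> = r}"
    by (auto simp: inv_states_def)
  ultimately show ?thesis by simp
qed

text \<open>Markov-Kakutani is applied to the states invariant at level \<open>Suc j\<close> with
  the prescribed rotation vector. Elements of \<open>\<Gamma> j\<close> preserve this set and
  commute on it, because their commutators lie in \<open>\<Gamma> (Suc j)\<close> and fix its
  points.\<close>

lemma ex_inv_state_descend:
  assumes \<phi>: "\<phi> \<in> H" "linear_part \<phi> (mat 1)" "is_lift \<Phi> \<phi>" and j: "j < n"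
    and L: "L \<in> inv_states \<phi> (Suc j)"
  shows "\<exists>L' \<in> inv_states \<phi> j. rot L' \<Phi> = rot L \<Phi>"
proof -
  let ?C = "inv_states \<phi> (Suc j) \<inter> {L'. rot L' \<Phi> = rot L \<Phi>}"
  \<comment> \<open>A state is a point whose coordinates are indexed by functions, so
    \<open>push g\<close> is precomposition with this map of the index set.\<close>
  let ?S = "(\<lambda>g f :: torus \<Rightarrow> real. f \<circ> g) ` \<Gamma> j"
  have push_comp: "L \<circ> (\<lambda>f. f \<circ> g) = push g L" for L :: "(torus \<Rightarrow> real) \<Rightarrow> real" and g
    by (simp add: push_def fun_eq_iff)
  obtain L' where L': "L' \<in> ?C" "\<And>s. s \<in> ?S \<Longrightarrow> L' \<circ> s = L'"
  proof (rule markov_kakutani_composition[of ?C ?S])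
    show "compact ?C" by (rule compact_inv_states)
    show "?C \<noteq> {}" using L by blast
    show "(\<lambda>i. (1 - t) * x i + t * y i) \<in> ?C" if "x \<in> ?C" "y \<in> ?C" "0 \<le> t" "t \<le> 1" for x y t
    proof -
      have "push g (\<lambda>i. (1 - t) * x i + t * y i) = (\<lambda>i. (1 - t) * push g x i + t * push g y i)" for g
        by (simp add: push_def fun_eq_iff)
      moreover have "rot (\<lambda>i. (1 - t) * x i + t * y i) \<Phi> = (1 - t) *\<^sub>R rot x \<Phi> + t *\<^sub>R rot y \<Phi>"
        by (simp add: vec_eq_iff)
      ultimately show ?thesis
        using that by (auto simp: inv_states_def state_convex simp flip: scaleR_left_distrib)
    qed
    show "x \<circ> s \<in> ?C" if "x \<in> ?C" "s \<in> ?S" for x s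
      using that push_inv_states[OF \<phi>(1)] rot_push_inv_states[OF \<phi> _ j] by (auto simp: push_comp)
    show "x \<circ> s \<circ> t = x \<circ> t \<circ> s" if x: "x \<in> ?C" and s: "s \<in> ?S" and t: "t \<in> ?S" for x s t
    proof -
      obtain g h where g: "g \<in> \<Gamma> j" "s = (\<lambda>f. f \<circ> g)" and h: "h \<in> \<Gamma> j" "t = (\<lambda>f. f \<circ> h)"
        using s t by blast
      have "h \<circ> g = g \<circ> h \<circ> (finv h \<circ> finv g \<circ> h \<circ> g)"
        using homeo_cancel[OF homeo[OF subset[OF g(1)]]] homeo_cancel[OF homeo[OF subset[OF h(1)]]]
        by (simp add: fun_eq_iff)
      then have "push (h \<circ> g) x = push (g \<circ> h) (push (finv h \<circ> finv g \<circ> h \<circ> g) x)"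
        by (simp add: push_push)
      also have "\<dots> = push (g \<circ> h) x"
        using x commutator_closed[OF h(1) subset[OF g(1)]] by (simp add: inv_states_def)
      finally show ?thesis by (simp add: g h push_comp push_push)
    qed
  qed blast
  have "push \<gamma> L' = L'" if "\<gamma> \<in> \<Gamma> j" for \<gamma>
    using L'(2)[OF imageI[OF that]] by (simp only: push_comp)
  then have "L' \<in> inv_states \<phi> j" using L'(1) by (simp add: inv_states_def)
  then show ?thesis using L'(1) by blast
qed

lemma ex_invariant_state:
  assumes \<phi>: "\<phi> \<in> H" "linear_part \<phi> (mat 1)" "is_lift \<Phi> \<phi>" and L: "state L" "push \<phi> L = L"
  obtains L' where "state L'" "\<And>h. h \<in> H \<Longrightarrow> push h L' = L'" "rot L' \<Phi> = rot L \<Phi>"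
proof -
  have "\<exists>L' \<in> inv_states \<phi> 0. rot L' \<Phi> = rot L \<Phi>"
  proof (rule inc_induct[of 0 n])
    show "\<exists>L' \<in> inv_states \<phi> n. rot L' \<Phi> = rot L \<Phi>"
      using L last by (intro bexI[of _ L]) (auto simp: inv_states_def)
    show "\<exists>L' \<in> inv_states \<phi> j. rot L' \<Phi> = rot L \<Phi>"
      if "j < n" "\<exists>L' \<in> inv_states \<phi> (Suc j). rot L' \<Phi> = rot L \<Phi>" for j
      using that ex_inv_state_descend[OF \<phi>] by metis
  qed simp
  then show thesis using that first by (auto simp: inv_states_def)
qed

end

section \<open>Passing between states and measures\<close>

definition state_of :: "torus measure \<Rightarrow> (torus \<Rightarrow> real) \<Rightarrow> real" where
  "state_of M f = (if continuous_on UNIV f then LINT x|M. f x else 0)"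

lemma integrable_continuous_torus:
  fixes f :: "torus \<Rightarrow> 'b::{banach, second_countable_topology}"
  assumes M: "sets M = sets borel" "prob_space M" and f: "continuous_on UNIV f"
  shows "integrable M f"
proof -
  interpret prob_space M by (rule M)
  obtain B where "\<And>x. norm (f x) \<le> B"
    using compact_imp_bounded[OF compact_continuous_image[OF f compact_torus]] by (auto simp: bounded_iff)
  moreover have "f \<in> borel_measurable M"
    using borel_measurable_continuous_onI[OF f] measurable_cong_sets[OF M(1) refl] by blast
  ultimately show ?thesis by (intro integrable_const_bound[where B = B]) auto
qed

lemma state_state_of:
  assumes M: "sets M = sets borel" "prob_space M"
  shows "state (state_of M)"
proof -
  interpret prob_space M by (rule M)
  show ?thesis
    unfolding state_def state_of_def
    using integrable_continuous_torus[OF M, where 'b = real]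
    by (simp add: continuous_on_add continuous_on_mult_left prob_space)
qed

lemma homeo_measurable: "homeo g \<Longrightarrow> g \<in> borel \<rightarrow>\<^sub>M borel"
  by (intro borel_measurable_continuous_onI homeo_continuous)

lemma state_of_distr:
  assumes M: "sets M = sets borel" and g: "homeo g"
  shows "state_of (distr M borel g) = push g (state_of M)"
proof
  fix f :: "torus \<Rightarrow> real"
  have "g \<in> M \<rightarrow>\<^sub>M borel" using homeo_measurable[OF g] measurable_cong_sets[OF M refl] by blast
  then show "state_of (distr M borel g) f = push g (state_of M) f"
    using continuous_comp_homeo_iff[OF g, of f]
    by (auto simp: state_of_def push_def integral_distr borel_measurable_continuous_onI)
qed

lemma push_state_of: "M \<in> inv_measures g \<Longrightarrow> homeo g \<Longrightarrow> push g (state_of M) = state_of M"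
  by (metis (mono_tags, lifting) inv_measures_def mem_Collect_eq state_of_distr)

lemma continuous_displacement_vec:
  "continuous_on UNIV F \<Longrightarrow> equivariant F (mat 1) \<Longrightarrow> continuous_on UNIV (displacement F)"
  using continuous_on_vec_lambda[of UNIV "\<lambda>i x. displacement F x $ i"] continuous_displacement
  by simp

lemma rot_state_of:
  assumes M: "sets M = sets borel" "prob_space M" and F: "is_lift F \<phi>" "equivariant F (mat 1)"
  shows "rot (state_of M) F = rot_vec M F"
proof -
  have "integrable M (displacement F)"
    by (rule integrable_continuous_torus[OF M continuous_displacement_vec[OF is_liftD(1)[OF F(1)] F(2)]])
  then have "(LINT x|M. displacement F x $ i) = rot_vec M F $ i" for i
    unfolding rot_vec_def by (rule integral_bounded_linear[OF bounded_linear_vec_nth])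
  then show ?thesis
    using continuous_displacement[OF is_liftD(1)[OF F(1)] F(2)] by (simp add: vec_eq_iff state_of_def)
qed

lemma inv_measuresD:
  assumes "M \<in> inv_measures g"
  shows "sets M = sets borel" "prob_space M"
  using assms by (auto simp: inv_measures_def)

text \<open>One inclusion holds because \<open>\<phi> \<in> H\<close>. For the other, the state of
  \<open>\<mu>\<close> is replaced by an \<open>H\<close>-invariant one with the same rotation
  vector; Riesz represents it by a measure, and uniqueness of that measure turns invariance of the
  state into invariance of the measure.\<close>

lemma (in central_filtration) rotation_set_eq:
  assumes \<phi>: "\<phi> \<in> H" "linear_part \<phi> (mat 1)" "is_lift F \<phi>"
  shows "{rot_vec \<mu> F | \<mu>. \<mu> \<in> inv_measures \<phi>} = {rot_vec \<nu> F | \<nu>. \<nu> \<in> inv_measures_group H}"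
proof
  show "{rot_vec \<nu> F | \<nu>. \<nu> \<in> inv_measures_group H} \<subseteq> {rot_vec \<mu> F | \<mu>. \<mu> \<in> inv_measures \<phi>}"
    using \<phi>(1) by (auto simp: inv_measures_group_def)
  have eF: "equivariant F (mat 1)" by (rule equivariant_lift[OF \<phi>(2,3)])
  show "{rot_vec \<mu> F | \<mu>. \<mu> \<in> inv_measures \<phi>} \<subseteq> {rot_vec \<nu> F | \<nu>. \<nu> \<in> inv_measures_group H}"
  proof clarify
    fix \<mu> assume \<mu>: "\<mu> \<in> inv_measures \<phi>"
    note \<mu>' = inv_measuresD[OF \<mu>]
    obtain L where L: "state L" "\<And>h. h \<in> H \<Longrightarrow> push h L = L" "rot L F = rot (state_of \<mu>) F"
      using ex_invariant_state[OF \<phi> state_state_of[OF \<mu>'] push_state_of[OF \<mu> homeo[OF \<phi>(1)]]] by blast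
    obtain \<nu> where \<nu>: "sets \<nu> = sets borel" "prob_space \<nu>" "\<And>f. continuous_on UNIV f \<Longrightarrow> (LINT x|\<nu>. f x) = L f"
      using riesz_representation[OF L(1) compact_torus] by blast
    have L_eq: "state_of \<nu> = L"
      using \<nu>(3) state_discontinuous[OF L(1)] by (auto simp: state_of_def fun_eq_iff)
    have "\<nu> \<in> inv_measures h" if h: "h \<in> H" for h
    proof -
      have meas: "h \<in> \<nu> \<rightarrow>\<^sub>M borel"
        using homeo_measurable[OF homeo[OF h]] measurable_cong_sets[OF \<nu>(1) refl] by blast
      have "state_of (distr \<nu> borel h) = state_of \<nu>"
        using state_of_distr[OF \<nu>(1) homeo[OF h]] L(2)[OF h] by (simp add: L_eq)
      then have "(LINT x|distr \<nu> borel h. f x) = (LINT x|\<nu>. f x)" if "continuous_on UNIV f" for f :: "torus \<Rightarrow> real"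
        using that by (metis state_of_def)
      then have "distr \<nu> borel h = \<nu>"
        using \<nu>(1,2) prob_space.prob_space_distr[OF \<nu>(2) meas] by (intro prob_measure_eqI_continuous) auto
      then show ?thesis using \<nu> by (simp add: inv_measures_def)
    qed
    then have "\<nu> \<in> inv_measures_group H" by (simp add: inv_measures_group_def)
    moreover have "rot_vec \<mu> F = rot_vec \<nu> F"
      using L(3) rot_state_of[OF \<mu>' \<phi>(3) eF] rot_state_of[OF \<nu>(1,2) \<phi>(3) eF] by (simp add: L_eq)
    ultimately show "\<exists>\<nu>. rot_vec \<mu> F = rot_vec \<nu> F \<and> \<nu> \<in> inv_measures_group H" by blast
  qed
qed

section \<open>The lower central series\<close>

context group
begin

abbreviation (input) commutator :: "'a \<Rightarrow> 'a \<Rightarrow> 'a" where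
  "commutator x y \<equiv> x \<otimes> y \<otimes> inv x \<otimes> inv y"

lemma lower_central_closed: "lower_central G n \<subseteq> carrier G"
proof (induction n)
  case (Suc n)
  then have "{commutator x y | x y. x \<in> lower_central G n \<and> y \<in> carrier G} \<subseteq> carrier G"
    by blast
  then show ?case using generate_incl by simp
qed simp

lemma commutator_in_lower_central:
  "x \<in> lower_central G n \<Longrightarrow> y \<in> carrier G \<Longrightarrow> commutator x y \<in> lower_central G (Suc n)"
  unfolding lower_central.simps by (rule generate.incl) blast

lemma generate_conjugation_closed:
  assumes S: "S \<subseteq> carrier G" and g: "g \<in> carrier G"
    and conj: "\<And>s. s \<in> S \<Longrightarrow> g \<otimes> s \<otimes> inv g \<in> S" and x: "x \<in> generate G S"
  shows "g \<otimes> x \<otimes> inv g \<in> generate G S"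
  using x
proof (induction rule: generate.induct)
  case one
  then show ?case using g by (simp add: generate.one)
next
  case (incl h)
  then show ?case by (intro generate.incl conj)
next
  case (inv h)
  then have "g \<otimes> inv h \<otimes> inv g = inv (g \<otimes> h \<otimes> inv g)"
    using S g by (auto simp: subset_iff inv_mult_group m_assoc)
  then show ?case using generate.inv[OF conj[OF inv]] by simp
next
  case (eng h1 h2)
  then have c: "h1 \<in> carrier G" "h2 \<in> carrier G"
    using generate_in_carrier[OF S] by auto
  have "g \<otimes> (h1 \<otimes> h2) \<otimes> inv g = (g \<otimes> h1 \<otimes> inv g) \<otimes> (g \<otimes> h2 \<otimes> inv g)"
  proof -
    have "inv g \<otimes> (g \<otimes> (h2 \<otimes> inv g)) = h2 \<otimes> inv g"
      using c g by (simp add: m_assoc[symmetric])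
    then show ?thesis using c g by (simp add: m_assoc)
  qed
  then show ?case using generate.eng[OF eng.IH] by simp
qed

lemma conjugate_commutator:
  assumes "x \<in> carrier G" "y \<in> carrier G" "g \<in> carrier G"
  shows "g \<otimes> commutator x y \<otimes> inv g = commutator (g \<otimes> x \<otimes> inv g) (g \<otimes> y \<otimes> inv g)"
proof -
  have cancel: "inv g \<otimes> (g \<otimes> z) = z" if "z \<in> carrier G" for z
    using that assms by (simp add: m_assoc[symmetric])
  show ?thesis using assms by (simp add: m_assoc inv_mult_group cancel)
qed

text \<open>Conjugation respects commutators, so by induction it maps the generators of each term to
  generators.\<close>

lemma lower_central_conjugation_closed:
  "x \<in> lower_central G n \<Longrightarrow> g \<in> carrier G \<Longrightarrow> g \<otimes> x \<otimes> inv g \<in> lower_central G n"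
proof (induction n arbitrary: x)
  case (Suc n)
  have *: "lower_central G n \<subseteq> carrier G" by (rule lower_central_closed)
  show ?case
    unfolding lower_central.simps
  proof (rule generate_conjugation_closed)
    show "x \<in> generate G {commutator x y | x y. x \<in> lower_central G n \<and> y \<in> carrier G}"
      using Suc.prems(1) by simp
    fix s assume "s \<in> {commutator x y | x y. x \<in> lower_central G n \<and> y \<in> carrier G}"
    then obtain a b where ab: "s = commutator a b" "a \<in> lower_central G n" "b \<in> carrier G"
      by blast
    have "g \<otimes> s \<otimes> inv g = commutator (g \<otimes> a \<otimes> inv g) (g \<otimes> b \<otimes> inv g)"
      using ab * Suc.prems(2) by (auto simp only: conjugate_commutator subset_iff)
    moreover have "g \<otimes> a \<otimes> inv g \<in> lower_central G n" "g \<otimes> b \<otimes> inv g \<in> carrier G"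
      using Suc ab by auto
    ultimately show "g \<otimes> s \<otimes> inv g \<in> {commutator x y | x y. x \<in> lower_central G n \<and> y \<in> carrier G}"
      by blast
  qed (use * Suc.prems(2) in auto)
qed simp

lemma lower_central_subgroup: "subgroup (lower_central G n) G"
proof (cases n)
  case (Suc m)
  show ?thesis
    unfolding Suc lower_central.simps
    using lower_central_closed[of m] by (intro generate_is_subgroup) auto
qed (simp add: subgroup_self)

text \<open>A commutator of \<open>x\<close> and \<open>y\<close> is \<open>x\<close> times a
  conjugate of \<open>inv x\<close>, so it stays in the normal subgroup containing
  \<open>x\<close>.\<close>

lemma lower_central_Suc_subset: "lower_central G (Suc n) \<subseteq> lower_central G n"
proof -
  interpret S: subgroup "lower_central G n" G by (rule lower_central_subgroup)
  have "commutator x y \<in> lower_central G n" if x: "x \<in> lower_central G n" and y: "y \<in> carrier G" for x y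
  proof -
    have "y \<otimes> inv x \<otimes> inv y \<in> lower_central G n"
      using x y by (intro lower_central_conjugation_closed) auto
    then have "x \<otimes> (y \<otimes> inv x \<otimes> inv y) \<in> lower_central G n" using x by simp
    then show ?thesis using x y S.subset by (simp add: m_assoc subset_iff)
  qed
  then have "generate G {commutator x y | x y. x \<in> lower_central G n \<and> y \<in> carrier G} \<subseteq> lower_central G n"
    by (intro generate_subgroup_incl[OF _ S.subgroup_axioms]) auto
  then show ?thesis by simp
qed

lemma lower_central_antimono: "m \<le> n \<Longrightarrow> lower_central G n \<subseteq> lower_central G m"
  by (rule lift_Suc_antimono_le[of "lower_central G", OF lower_central_Suc_subset])

end

section \<open>The congruence subgroup of level 3\<close>

lemma matrix_add_mult:
  fixes A B C :: "real ^ 2 ^ 2"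
  shows "(A + B) ** C = A ** C + B ** C"
  by (simp add: vec_eq_iff matrix_matrix_mult_def sum.distrib distrib_right)

lemma matrix_scaleR_mult:
  fixes A B :: "real ^ 2 ^ 2"
  shows "(c *\<^sub>R A) ** B = c *\<^sub>R (A ** B)" "A ** (c *\<^sub>R B) = c *\<^sub>R (A ** B)"
  by (simp_all add: matrix_scalar_ac flip: scalar_matrix_assoc)

lemma level3_mat_1: "level3 (mat 1)"
  unfolding level3_def by (intro exI[of _ 0]) (simp add: int_mat_def)

lemma int_mat_add: "int_mat A \<Longrightarrow> int_mat B \<Longrightarrow> int_mat (A + B)"
  by (simp add: int_mat_def)

text \<open>Matrices congruent modulo 3 differ by a factor of level 3; this is what makes the index
  finite.\<close>

lemma level3_congruent:
  assumes "int_mat C" "int_mat B'" "(B + 3 *\<^sub>R C) ** B' = A" "B ** B' = mat 1"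
  shows "level3 A"
proof -
  have "A = mat 1 + 3 *\<^sub>R (C ** B')"
    using assms(3,4) by (simp add: matrix_add_mult matrix_scaleR_mult)
  then show ?thesis using assms int_mat_mult by (auto simp: level3_def)
qed

lemma level3_mult:
  assumes "level3 A" "level3 B" "int_mat B"
  shows "level3 (A ** B)"
proof -
  obtain C D where C: "int_mat C" "A = mat 1 + 3 *\<^sub>R C" and D: "int_mat D" "B = mat 1 + 3 *\<^sub>R D"
    using assms by (auto simp: level3_def)
  have "A ** B = B + (3 *\<^sub>R C) ** B" unfolding C(2) by (simp add: matrix_add_mult)
  also have "\<dots> = mat 1 + 3 *\<^sub>R (D + C ** B)"
    by (simp add: D(2) matrix_scaleR_mult scaleR_add_right)
  finally show ?thesis using assms C D by (auto simp: level3_def int_mat_add int_mat_mult)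
qed

lemma level3_inverse:
  assumes "level3 A" "A ** B = mat 1" "int_mat B"
  shows "level3 B"
proof -
  obtain C where C: "int_mat C" "A = mat 1 + 3 *\<^sub>R C" using assms by (auto simp: level3_def)
  have "B + 3 *\<^sub>R (C ** B) = mat 1"
    using assms(2) unfolding C(2) by (simp add: matrix_add_mult matrix_scaleR_mult)
  then have "B = mat 1 + 3 *\<^sub>R ((- 1) *\<^sub>R (C ** B))" by (simp add: algebra_simps)
  moreover have "int_mat ((- 1) *\<^sub>R (C ** B))"
    using int_mat_mult[OF C(1) assms(3)] by (simp add: int_mat_def)
  ultimately show ?thesis by (auto simp: level3_def)
qed

lemma level3_conjugate:
  assumes "level3 M" "int_mat A" "int_mat B" "A ** B = mat 1"
  shows "level3 (A ** M ** B)"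
proof -
  obtain C where C: "int_mat C" "M = mat 1 + 3 *\<^sub>R C" using assms by (auto simp: level3_def)
  have "A ** M ** B = mat 1 + 3 *\<^sub>R (A ** C ** B)"
    unfolding C(2) using assms(4)
    by (simp add: matrix_add_ldistrib matrix_add_mult matrix_scaleR_mult)
  then show ?thesis using assms C by (auto simp: level3_def int_mat_mult)
qed

section \<open>Composition, inversion and conjugation of isotopies\<close>

lemma homeomorphic_map_iff_homeo: "homeomorphic_map euclidean euclidean g \<longleftrightarrow> homeo g"
  using carrier_Homeo_T2 by (auto simp: Homeo_T2_def)

lemma isotopic_to_id_iff: "isotopic_to_id \<phi> \<longleftrightarrow> homotopic_with homeo euclidean euclidean id \<phi>"
  by (simp add: isotopic_to_id_def homeomorphic_map_iff_homeo)

lemma isotopic_to_id_homeo: "isotopic_to_id \<phi> \<Longrightarrow> homeo \<phi>"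
  unfolding isotopic_to_id_iff by (drule homotopic_with_imp_property) simp

lemma homeo_id: "homeo id"
  by (simp add: homeo_def)

lemma isotopic_to_id_id: "isotopic_to_id id"
  by (simp add: isotopic_to_id_iff homeo_id)

lemma homotopic_homeo_compose_left:
  "homotopic_with homeo euclidean euclidean f g \<Longrightarrow> homeo h \<Longrightarrow>
    homotopic_with homeo euclidean euclidean (h \<circ> f) (h \<circ> g)"
  by (rule homotopic_with_compose_continuous_map_left[where p = homeo])
    (auto simp: homeo_compose homeo_continuous)

lemma homotopic_homeo_compose_right:
  "homotopic_with homeo euclidean euclidean f g \<Longrightarrow> homeo h \<Longrightarrow>
    homotopic_with homeo euclidean euclidean (f \<circ> h) (g \<circ> h)"
  by (rule homotopic_with_compose_continuous_map_right[where p = homeo])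
    (auto simp: homeo_compose homeo_continuous)

lemma isotopic_to_id_compose:
  assumes "isotopic_to_id \<phi>" "isotopic_to_id \<psi>"
  shows "isotopic_to_id (\<phi> \<circ> \<psi>)"
  using homotopic_with_trans[of homeo euclidean euclidean id \<phi> "\<phi> \<circ> \<psi>"]
    homotopic_homeo_compose_left[of id \<psi> \<phi>] isotopic_to_id_homeo[OF assms(1)] assms
  by (simp add: isotopic_to_id_iff)

lemma isotopic_to_id_inv:
  assumes "isotopic_to_id \<phi>"
  shows "isotopic_to_id (finv \<phi>)"
  using homotopic_homeo_compose_right[of id \<phi> "finv \<phi>"] isotopic_to_id_homeo[OF assms] assms
  by (simp add: isotopic_to_id_iff homeo_inv homeo_cancel homotopic_with_symD)

lemma isotopic_to_id_conjugate:
  assumes "isotopic_to_id \<phi>" "homeo g"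
  shows "isotopic_to_id (g \<circ> \<phi> \<circ> finv g)"
  using homotopic_homeo_compose_right[OF homotopic_homeo_compose_left[of id \<phi> g], of "finv g"] assms
  by (simp add: isotopic_to_id_iff homeo_inv homeo_cancel)

lemma rot_vec_id: "rot_vec \<nu> id = 0"
  by (simp add: rot_vec_def displacement_def)

section \<open>Finitely many residue classes of matrices\<close>

lemma finite_image_of_finite_classes:
  assumes "finite (r ` S)" "\<And>a b. a \<in> S \<Longrightarrow> b \<in> S \<Longrightarrow> r a = r b \<Longrightarrow> f a = f b"
  shows "finite (f ` S)"
proof -
  have "f a \<in> (\<lambda>c. f (inv_into S r c)) ` r ` S" if "a \<in> S" for a
  proof -
    have "f a = f (inv_into S r (r a))"
      using that by (intro assms(2)) (auto simp: inv_into_into f_inv_into_f)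
    then show ?thesis using that by blast
  qed
  then have "f ` S \<subseteq> (\<lambda>c. f (inv_into S r c)) ` r ` S" by (rule image_subsetI)
  then show ?thesis by (rule finite_subset) (intro finite_imageI assms(1))
qed

definition residues3 :: "real ^ 2 ^ 2 \<Rightarrow> 2 \<Rightarrow> 2 \<Rightarrow> int" where
  "residues3 A = (\<lambda>i j. \<lfloor>A $ i $ j\<rfloor> mod 3)"

lemma finite_residues3: "finite (range residues3)"
proof -
  have "range residues3 \<subseteq> Pi\<^sub>E UNIV (\<lambda>_. Pi\<^sub>E UNIV (\<lambda>_. {0..<3}))"
    by (auto simp: residues3_def)
  then show ?thesis by (rule finite_subset) (intro finite_PiE; simp)+
qed

lemma residues3_eq_imp:
  assumes "int_mat A" "int_mat B" "residues3 A = residues3 B"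
  obtains C where "int_mat C" "A = B + 3 *\<^sub>R C"
proof
  define C :: "real ^ 2 ^ 2" where "C = (\<chi> i j. of_int ((\<lfloor>A $ i $ j\<rfloor> - \<lfloor>B $ i $ j\<rfloor>) div 3))"
  show "int_mat C" by (simp add: int_mat_def C_def)
  have "A $ i $ j = B $ i $ j + 3 * C $ i $ j" for i j
  proof -
    have "\<lfloor>A $ i $ j\<rfloor> mod 3 = \<lfloor>B $ i $ j\<rfloor> mod 3"
      using fun_cong[OF fun_cong[OF assms(3), of i], of j] by (simp add: residues3_def)
    then have "3 dvd \<lfloor>A $ i $ j\<rfloor> - \<lfloor>B $ i $ j\<rfloor>" by (rule mod_eq_dvd_iff[THEN iffD1])
    then have "3 * ((\<lfloor>A $ i $ j\<rfloor> - \<lfloor>B $ i $ j\<rfloor>) div 3) = \<lfloor>A $ i $ j\<rfloor> - \<lfloor>B $ i $ j\<rfloor>" by simp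
    then have "3 * C $ i $ j = of_int (\<lfloor>A $ i $ j\<rfloor> - \<lfloor>B $ i $ j\<rfloor>)"
      unfolding C_def by (metis (no_types) of_int_mult of_int_numeral vec_lambda_beta)
    moreover have "of_int \<lfloor>A $ i $ j\<rfloor> = A $ i $ j" "of_int \<lfloor>B $ i $ j\<rfloor> = B $ i $ j"
      using assms(1,2) by (auto simp: int_mat_def)
    ultimately show ?thesis by simp
  qed
  then show "A = B + 3 *\<^sub>R C" by (simp add: vec_eq_iff)
qed

section \<open>The finite index subgroup of a group of homeomorphisms\<close>

locale homeo_group =
  fixes G :: "(torus \<Rightarrow> torus) set"
  assumes G: "subgroup G Homeo_T2"
begin

abbreviation "GG \<equiv> Homeo_T2\<lparr>carrier := G\<rparr>"

lemma group_GG: "group GG"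
  by (rule subgroup.subgroup_is_group[OF G group_Homeo_T2])

lemma Homeo_T2_simps [simp]: "x \<otimes>\<^bsub>Homeo_T2\<^esub> y = x \<circ> y" "\<one>\<^bsub>Homeo_T2\<^esub> = id"
  by (simp_all add: Homeo_T2_def)

lemma GG_simps [simp]: "carrier GG = G" "x \<otimes>\<^bsub>GG\<^esub> y = x \<circ> y" "\<one>\<^bsub>GG\<^esub> = id"
  by (simp_all add: Homeo_T2_def)

lemma G_homeo: "g \<in> G \<Longrightarrow> homeo g"
  using subgroup.subset[OF G] carrier_Homeo_T2 by blast

lemma inv_GG:
  assumes "g \<in> G"
  shows "inv\<^bsub>GG\<^esub> g = finv g" "finv g \<in> G"
proof -
  interpret group GG by (rule group_GG)
  have h: "inv\<^bsub>GG\<^esub> g \<in> G" "inv\<^bsub>GG\<^esub> g \<circ> g = id" "g \<circ> inv\<^bsub>GG\<^esub> g = id"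
    using inv_closed[of g] l_inv[of g] r_inv[of g] assms by simp_all
  then have "finv g = inv\<^bsub>GG\<^esub> g" by (intro inv_unique_comp) auto
  then show "inv\<^bsub>GG\<^esub> g = finv g" "finv g \<in> G" using h by simp_all
qed

lemma G_id: "id \<in> G" and G_comp: "g \<in> G \<Longrightarrow> h \<in> G \<Longrightarrow> g \<circ> h \<in> G"
  using group.is_monoid[OF group_GG] monoid.one_closed[of GG] monoid.m_closed[of GG g h] by simp_all

lemma subgroup_GG_iff:
  "subgroup N GG \<longleftrightarrow> N \<subseteq> G \<and> id \<in> N \<and> (\<forall>x\<in>N. \<forall>y\<in>N. x \<circ> y \<in> N) \<and> (\<forall>x\<in>N. finv x \<in> N)"
  unfolding subgroup_def using inv_GG by (auto simp: subset_iff)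

lemma normal_GG_iff:
  "N \<lhd> GG \<longleftrightarrow> subgroup N GG \<and> (\<forall>x\<in>G. \<forall>h\<in>N. x \<circ> h \<circ> finv x \<in> N)"
  using group.normal_inv_iff[OF group_GG, of N] inv_GG by simp

text \<open>The preimage of the principal congruence subgroup of level 3 under the action on the
  fundamental group.\<close>

definition H :: "(torus \<Rightarrow> torus) set" where
  "H = {g \<in> G. \<exists>A. linear_part g A \<and> level3 A}"

lemma H_normal: "H \<lhd> GG"
  unfolding normal_GG_iff subgroup_GG_iff
proof (intro conjI ballI)
  show "H \<subseteq> G" by (auto simp: H_def)
  show "id \<in> H" using G_id linear_part_id level3_mat_1 by (auto simp: H_def)
next
  fix x y assume "x \<in> H" "y \<in> H"
  then show "x \<circ> y \<in> H"
    unfolding H_def using G_comp linear_part_compose level3_mult linear_part_int_mat by blast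
next
  fix x assume "x \<in> H"
  then obtain A where x: "x \<in> G" "linear_part x A" "level3 A" by (auto simp: H_def)
  obtain B where "linear_part (finv x) B" "A ** B = mat 1"
    using linear_part_inv[OF G_homeo[OF x(1)] x(2)] .
  then show "finv x \<in> H"
    unfolding H_def using inv_GG(2)[OF x(1)] level3_inverse[OF x(3)] linear_part_int_mat by blast
next
  fix x h assume x: "x \<in> G" and "h \<in> H"
  then obtain M where h: "h \<in> G" "linear_part h M" "level3 M" by (auto simp: H_def)
  obtain A where A: "linear_part x A" using ex_linear_part[OF homeo_continuous[OF G_homeo[OF x]]] by blast
  obtain B where B: "linear_part (finv x) B" "A ** B = mat 1"
    using linear_part_inv[OF G_homeo[OF x] A] .
  have "linear_part (x \<circ> h \<circ> finv x) (A ** M ** B)"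
    by (intro linear_part_compose A B h)
  moreover have "level3 (A ** M ** B)"
    using A B h by (intro level3_conjugate) (auto dest: linear_part_int_mat)
  ultimately show "x \<circ> h \<circ> finv x \<in> H"
    unfolding H_def using x h inv_GG(2)[OF x] G_comp by blast
qed

text \<open>A coset of \<open>H\<close> is determined by the residues modulo 3 of the linear part,
  of which there are finitely many.\<close>

lemma H_finite_index: "finite (rcosets\<^bsub>GG\<^esub> H)"
proof -
  interpret group GG by (rule group_GG)
  have H: "subgroup H GG" using H_normal by (simp add: normal_GG_iff)
  define A where "A g = (SOME A. linear_part g A)" for g
  have A: "linear_part g (A g)" if "g \<in> G" for g
    unfolding A_def using ex_linear_part[OF homeo_continuous[OF G_homeo[OF that]]] by (rule someI_ex)
  have "finite ((\<lambda>g. H #>\<^bsub>GG\<^esub> g) ` G)"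
  proof (rule finite_image_of_finite_classes)
    show "finite ((\<lambda>g. residues3 (A g)) ` G)"
      by (rule finite_subset[OF _ finite_residues3]) auto
    fix a b assume a: "a \<in> G" and b: "b \<in> G" and eq: "residues3 (A a) = residues3 (A b)"
    obtain C where C: "int_mat C" "A a = A b + 3 *\<^sub>R C"
      using residues3_eq_imp[OF linear_part_int_mat[OF A[OF a]] linear_part_int_mat[OF A[OF b]] eq] .
    obtain B' where B': "linear_part (finv b) B'" "A b ** B' = mat 1"
      using linear_part_inv[OF G_homeo[OF b] A[OF b]] .
    have "level3 (A a ** B')"
      by (rule level3_congruent[OF C(1) linear_part_int_mat[OF B'(1)] _ B'(2)])
        (simp add: C(2))
    then have "a \<circ> finv b \<in> H"
      unfolding H_def using G_comp[OF a inv_GG(2)[OF b]] linear_part_compose[OF A[OF a] B'(1)] by blast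
    moreover have "a = (a \<circ> finv b) \<otimes>\<^bsub>GG\<^esub> b"
      using homeo_cancel[OF G_homeo[OF b]] by (simp add: fun_eq_iff)
    ultimately have "a \<in> H #>\<^bsub>GG\<^esub> b" unfolding r_coset_def by blast
    then show "H #>\<^bsub>GG\<^esub> a = H #>\<^bsub>GG\<^esub> b"
      using repr_independence[of a H b] b H by simp
  qed
  then show ?thesis by (simp add: RCOSETS_def UNION_singleton_eq_range)
qed

lemma id_part_subset_H: "id_part G \<subseteq> H"
  using linear_part_isotopic_to_id level3_mat_1 by (auto simp: id_part_def H_def)

text \<open>Normality of \<open>H\<close> lets \<open>G\<close> act on the
  \<open>H\<close>-invariant measures; this is used for conjugates of irrotational maps.\<close>

lemma inv_measures_group_conjugate:
  assumes g: "g \<in> G" and \<nu>: "\<nu> \<in> inv_measures_group H"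
  shows "distr \<nu> borel (finv g) \<in> inv_measures_group H"
proof -
  have idH: "id \<in> H" using H_normal by (simp add: normal_GG_iff subgroup_GG_iff)
  have \<nu>': "sets \<nu> = sets borel" "prob_space \<nu>"
    using \<nu> idH inv_measuresD[of \<nu> id] by (simp_all add: inv_measures_group_def)
  have meas: "k \<in> \<nu> \<rightarrow>\<^sub>M borel" if "homeo k" for k
    using homeo_measurable[OF that] measurable_cong_sets[OF \<nu>'(1) refl] by blast
  have hg: "homeo (finv g)" using G_homeo[OF g] by (rule homeo_inv)
  have "distr \<nu> borel (finv g) \<in> inv_measures h" if h: "h \<in> H" for h
  proof -
    have hh: "homeo h" using h G_homeo by (auto simp: H_def)
    let ?k = "g \<circ> h \<circ> finv g"
    have k: "?k \<in> H" using H_normal g h by (simp add: normal_GG_iff)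
    then have hk: "homeo ?k" using G_homeo by (auto simp: H_def)
    have "distr (distr \<nu> borel (finv g)) borel h = distr \<nu> borel (h \<circ> finv g)"
      by (rule distr_distr[OF homeo_measurable[OF hh] meas[OF hg]])
    also have "h \<circ> finv g = finv g \<circ> ?k"
      using homeo_cancel[OF G_homeo[OF g]] by (simp add: fun_eq_iff)
    also have "distr \<nu> borel (finv g \<circ> ?k) = distr (distr \<nu> borel ?k) borel (finv g)"
      by (rule distr_distr[OF homeo_measurable[OF hg] meas[OF hk], symmetric])
    also have "distr \<nu> borel ?k = \<nu>"
      using \<nu> k by (auto simp: inv_measures_group_def inv_measures_def)
    finally show ?thesis
      using prob_space.prob_space_distr[OF \<nu>'(2) meas[OF hg]] by (simp add: inv_measures_def)
  qed
  then show ?thesis by (simp add: inv_measures_group_def)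
qed

end

section \<open>Rotation sets and irrotational elements for nilpotent groups\<close>

locale nilpotent_homeo_group = homeo_group +
  assumes nilpotent: "nilpotent GG"
begin

lemma ex_central_filtration: "\<exists>\<Gamma> n. central_filtration H \<Gamma> n"
proof -
  interpret group GG by (rule group_GG)
  obtain n where n: "lower_central GG n = {id}" using nilpotent by (auto simp: nilpotent_def)
  have H: "subgroup H GG" using H_normal by (simp add: normal_GG_iff)
  have HG: "H \<subseteq> G" by (auto simp: H_def)
  have H_closed: "id \<in> H" "\<And>x y. x \<in> H \<Longrightarrow> y \<in> H \<Longrightarrow> x \<circ> y \<in> H" "\<And>x. x \<in> H \<Longrightarrow> finv x \<in> H"
    using H by (simp_all add: subgroup_GG_iff)
  have S: "x \<in> lower_central GG j \<Longrightarrow> y \<in> lower_central GG j \<Longrightarrow> x \<circ> y \<in> lower_central GG j"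
    "x \<in> lower_central GG j \<Longrightarrow> finv x \<in> lower_central GG j" for x y j
    using lower_central_subgroup[of j] by (simp_all add: subgroup_GG_iff)
  show ?thesis
  proof (intro exI, unfold_locales)
    let ?\<Gamma> = "\<lambda>j. lower_central GG j \<inter> H"
    show "g \<in> H \<Longrightarrow> homeo g" for g using HG G_homeo by blast
    show "g \<in> H \<Longrightarrow> \<exists>A. linear_part g A \<and> level3 A" for g by (simp add: H_def)
    show "g \<in> ?\<Gamma> j \<Longrightarrow> finv g \<in> ?\<Gamma> j" for g j using S H_closed by simp
    show "g \<in> ?\<Gamma> j \<Longrightarrow> h \<in> ?\<Gamma> j \<Longrightarrow> g \<circ> h \<in> ?\<Gamma> j" for g h j using S H_closed by simp
    show "j \<le> m \<Longrightarrow> ?\<Gamma> m \<subseteq> ?\<Gamma> j" for j m using lower_central_antimono[of j m] by auto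
    show "?\<Gamma> 0 = H" using HG by auto
    show "?\<Gamma> n = {id}" using n H_closed by auto
    show "finv g \<circ> finv h \<circ> g \<circ> h \<in> ?\<Gamma> (Suc j)" if g: "g \<in> ?\<Gamma> j" and h: "h \<in> H" for g h j
    proof
      have gG: "g \<in> G" and hG: "h \<in> G" using g h HG by auto
      have inv: "finv (finv g) = g" "finv (finv h) = h"
        using G_homeo gG hG by (auto simp: homeo_def inv_inv_eq)
      \<comment> \<open>The filtration's commutator of \<open>g\<close> and \<open>h\<close> is the
        group commutator of their inverses.\<close>
      have "finv g \<otimes>\<^bsub>GG\<^esub> finv h \<otimes>\<^bsub>GG\<^esub> inv\<^bsub>GG\<^esub> (finv g) \<otimes>\<^bsub>GG\<^esub> inv\<^bsub>GG\<^esub> (finv h) \<in> lower_central GG (Suc j)"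
        using S(2)[of g j] g inv_GG(2)[OF hG] by (intro commutator_in_lower_central) auto
      then show "finv g \<circ> finv h \<circ> g \<circ> h \<in> lower_central GG (Suc j)"
        using inv_GG(1)[OF inv_GG(2)[OF gG]] inv_GG(1)[OF inv_GG(2)[OF hG]]
        by (simp only: GG_simps inv)
      show "finv g \<circ> finv h \<circ> g \<circ> h \<in> H" using g h H_closed by simp
    qed
  qed
qed

lemma rotation_set_H:
  assumes "\<phi> \<in> id_part G" "is_lift F \<phi>"
  shows "{rot_vec \<mu> F | \<mu>. \<mu> \<in> inv_measures \<phi>} = {rot_vec \<nu> F | \<nu>. \<nu> \<in> inv_measures_group H}"
proof -
  obtain \<Gamma> n where "central_filtration H \<Gamma> n" using ex_central_filtration by blast
  moreover have "\<phi> \<in> H" using assms(1) id_part_subset_H by blast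
  moreover have "linear_part \<phi> (mat 1)" using assms(1) linear_part_isotopic_to_id by (simp add: id_part_def)
  ultimately show ?thesis using assms(2) by (rule central_filtration.rotation_set_eq)
qed

text \<open>Replaces the measures invariant under \<open>\<phi>\<close>, which vary with
  \<open>\<phi>\<close>, by one common class of measures on which rotation vectors are
  additive.\<close>

lemma irrotational_iff:
  "\<phi> \<in> irrotational G \<longleftrightarrow>
     \<phi> \<in> id_part G \<and> (\<exists>F. is_lift F \<phi> \<and> (\<forall>\<nu> \<in> inv_measures_group H. rot_vec \<nu> F = 0))"
proof -
  have "(\<forall>\<mu> \<in> inv_measures \<phi>. rot_vec \<mu> F = 0) \<longleftrightarrow> (\<forall>\<nu> \<in> inv_measures_group H. rot_vec \<nu> F = 0)"
    if "\<phi> \<in> id_part G" "is_lift F \<phi>" for F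
  proof -
    have "(\<forall>\<mu> \<in> inv_measures \<phi>. rot_vec \<mu> F = 0) \<longleftrightarrow> {rot_vec \<mu> F | \<mu>. \<mu> \<in> inv_measures \<phi>} \<subseteq> {0}"
      by blast
    also have "\<dots> \<longleftrightarrow> (\<forall>\<nu> \<in> inv_measures_group H. rot_vec \<nu> F = 0)"
      unfolding rotation_set_H[OF that] by blast
    finally show ?thesis .
  qed
  then show ?thesis by (auto simp: irrotational_def)
qed

text \<open>On \<open>H\<close>-invariant measures, additivity of rotation vectors handles products
  and inverses. For a conjugate by \<open>g\<close>, \<open>rot_push\<close> expresses its rotation
  vector as the linear part of \<open>g\<close> applied to that of \<open>x\<close> for another
  \<open>H\<close>-invariant measure.\<close>

lemma irrotational_normal: "irrotational G \<lhd> GG"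
  unfolding normal_GG_iff subgroup_GG_iff
proof (intro conjI ballI)
  have id_partD: "\<phi> \<in> G" "homeo \<phi>" "\<phi> \<in> H" "isotopic_to_id \<phi>" "linear_part \<phi> (mat 1)" if "\<phi> \<in> id_part G" for \<phi>
    using that id_part_subset_H G_homeo linear_part_isotopic_to_id by (auto simp: id_part_def)
  have inv_meas: "sets \<nu> = sets borel" "prob_space \<nu>" "push \<phi> (state_of \<nu>) = state_of \<nu>"
    if "\<nu> \<in> inv_measures_group H" "\<phi> \<in> id_part G" for \<nu> \<phi>
  proof -
    have "\<nu> \<in> inv_measures \<phi>" using that id_partD(3) by (simp add: inv_measures_group_def)
    then show "sets \<nu> = sets borel" "prob_space \<nu>" "push \<phi> (state_of \<nu>) = state_of \<nu>"
      using inv_measuresD push_state_of id_partD(2)[OF that(2)] by auto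
  qed
  have rot_comp: "rot_vec \<nu> (P \<circ> Q) = rot_vec \<nu> P + rot_vec \<nu> Q"
    if \<nu>: "\<nu> \<in> inv_measures_group H" and p: "p \<in> id_part G" "is_lift P p" and q: "q \<in> id_part G" "is_lift Q q"
    for \<nu> P Q p q
  proof -
    note M = inv_meas(1,2)[OF \<nu> p(1)]
    note eP = equivariant_lift[OF id_partD(5)[OF p(1)] p(2)]
    note eQ = equivariant_lift[OF id_partD(5)[OF q(1)] q(2)]
    have ePQ: "equivariant (P \<circ> Q) (mat 1)" using equivariant_compose[OF eP eQ] by simp
    show ?thesis
      using rot_compose[OF state_state_of[OF M] p(2) eP q(2) eQ inv_meas(3)[OF \<nu> q(1)]]
      by (simp only: rot_state_of[OF M p(2) eP] rot_state_of[OF M q(2) eQ]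
          rot_state_of[OF M is_lift_compose[OF p(2) q(2)] ePQ])
  qed
  show "irrotational G \<subseteq> G" by (auto simp: irrotational_def id_part_def)
  show "id \<in> irrotational G"
    unfolding irrotational_iff using G_id isotopic_to_id_id is_lift_id rot_vec_id
    by (auto simp: id_part_def)
  {
    fix x y assume "x \<in> irrotational G" "y \<in> irrotational G"
    then obtain P Q where x: "x \<in> id_part G" "is_lift P x" "\<And>\<nu>. \<nu> \<in> inv_measures_group H \<Longrightarrow> rot_vec \<nu> P = 0"
      and y: "y \<in> id_part G" "is_lift Q y" "\<And>\<nu>. \<nu> \<in> inv_measures_group H \<Longrightarrow> rot_vec \<nu> Q = 0"
      unfolding irrotational_iff by blast
    have "x \<circ> y \<in> id_part G"
      using x(1) y(1) by (simp add: id_part_def G_comp isotopic_to_id_compose)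
    moreover have "rot_vec \<nu> (P \<circ> Q) = 0" if "\<nu> \<in> inv_measures_group H" for \<nu>
      using rot_comp[OF that x(1,2) y(1,2)] x(3)[OF that] y(3)[OF that] by simp
    ultimately show "x \<circ> y \<in> irrotational G"
      unfolding irrotational_iff using is_lift_compose[OF x(2) y(2)] by blast
  next
    fix x assume "x \<in> irrotational G"
    then obtain P where x: "x \<in> id_part G" "is_lift P x" "\<And>\<nu>. \<nu> \<in> inv_measures_group H \<Longrightarrow> rot_vec \<nu> P = 0"
      unfolding irrotational_iff by blast
    note hx = id_partD(2)[OF x(1)]
    obtain P' where P': "is_lift P' (finv x)" "P' \<circ> P = id"
      using inverse_lift[OF x(2) homeo_continuous[OF homeo_inv[OF hx]]] homeo_cancel[OF hx] by metis
    have x': "finv x \<in> id_part G"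
      using x(1) by (simp add: id_part_def inv_GG isotopic_to_id_inv)
    have "rot_vec \<nu> P' = 0" if "\<nu> \<in> inv_measures_group H" for \<nu>
      using rot_comp[OF that x' P'(1) x(1,2)] x(3)[OF that] P'(2) by (simp add: rot_vec_id)
    then show "finv x \<in> irrotational G"
      unfolding irrotational_iff using x' P'(1) by blast
  next
    fix g x assume g: "g \<in> G" and "x \<in> irrotational G"
    then obtain P where x: "x \<in> id_part G" "is_lift P x" "\<And>\<nu>. \<nu> \<in> inv_measures_group H \<Longrightarrow> rot_vec \<nu> P = 0"
      unfolding irrotational_iff by blast
    note hg = G_homeo[OF g]
    let ?c = "g \<circ> x \<circ> finv g"
    have c: "?c \<in> id_part G"
      using x(1) g hg by (simp add: id_part_def inv_GG G_comp isotopic_to_id_conjugate)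
    obtain F A where F: "is_lift F g" "linear_part g A"
      using ex_lift[OF homeo_continuous[OF hg]] ex_linear_part[OF homeo_continuous[OF hg]] by metis
    obtain F' where F': "is_lift F' (finv g)" "F' \<circ> F = id"
      using inverse_lift[OF F(1) homeo_continuous[OF homeo_inv[OF hg]]] homeo_cancel[OF hg] by metis
    let ?P = "F \<circ> P \<circ> F'"
    have liftc: "is_lift ?P ?c" by (intro is_lift_compose F F' x)
    note ec = equivariant_lift[OF id_partD(5)[OF c] liftc]
    note eP = equivariant_lift[OF id_partD(5)[OF x(1)] x(2)]
    have "rot_vec \<nu> ?P = 0" if \<nu>: "\<nu> \<in> inv_measures_group H" for \<nu>
    proof -
      let ?\<nu> = "distr \<nu> borel (finv g)"
      have \<nu>': "?\<nu> \<in> inv_measures_group H" by (rule inv_measures_group_conjugate[OF g \<nu>])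
      note M = inv_meas(1,2)[OF \<nu> x(1)] and M' = inv_meas(1,2)[OF \<nu>' x(1)]
      \<comment> \<open>The measure is recovered by pushing its image under \<open>finv g\<close>
        forward by \<open>g\<close>, the form in which \<open>rot_push\<close> applies.\<close>
      have "state_of \<nu> = push g (state_of ?\<nu>)"
        by (simp add: state_of_distr[OF M(1) homeo_inv[OF hg]] push_push homeo_cancel[OF hg])
      moreover have "?P \<circ> F = F \<circ> P" using F'(2) by (simp add: comp_assoc)
      ultimately have "rot (state_of \<nu>) ?P = A *v rot (state_of ?\<nu>) P"
        using rot_push[OF state_state_of[OF M'] F(1) equivariant_lift[OF F(2,1)] ec x(2) eP _
            id_partD(2)[OF x(1)] inv_meas(3)[OF \<nu>' x(1)]] by metis
      then show ?thesis
        by (simp only: rot_state_of[OF M liftc ec] rot_state_of[OF M' x(2) eP] x(3)[OF \<nu>'] matrix_vector_mult_0_right)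
    qed
    then show "?c \<in> irrotational G"
      unfolding irrotational_iff using c liftc by blast
  }
qed

text \<open>Maps isotopic to the identity have trivial linear part, so \<open>H\<close> is all of
  \<open>G\<close> and the two classes of measures coincide.\<close>

lemma irrotational_eq_group_irrotational:
  assumes "G = id_part G"
  shows "irrotational G = group_irrotational G"
proof -
  have "H = G" using assms id_part_subset_H by (auto simp: H_def)
  then show ?thesis using irrotational_iff by (auto simp: group_irrotational_def)
qed

end

theorem theorem1p6:
  fixes G :: "(torus \<Rightarrow> torus) set"
  assumes "subgroup G Homeo_T2"
    and "nilpotent (Homeo_T2\<lparr>carrier := G\<rparr>)"
  shows "(\<exists>H. H \<lhd> Homeo_T2\<lparr>carrier := G\<rparr>
            \<and> finite (rcosets\<^bsub>Homeo_T2\<lparr>carrier := G\<rparr>\<^esub> H)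
            \<and> id_part G \<subseteq> H
            \<and> (\<forall>\<phi> \<in> id_part G. \<forall>F. is_lift F \<phi> \<longrightarrow>
                  {rot_vec \<mu> F | \<mu>. \<mu> \<in> inv_measures \<phi>}
                = {rot_vec \<nu> F | \<nu>. \<nu> \<in> inv_measures_group H}))
       \<and> irrotational G \<lhd> Homeo_T2\<lparr>carrier := G\<rparr>
       \<and> (G = id_part G \<longrightarrow> irrotational G = group_irrotational G)"
proof -
  interpret nilpotent_homeo_group G
    by (intro nilpotent_homeo_group.intro homeo_group.intro nilpotent_homeo_group_axioms.intro assms)
  show ?thesis
    using H_normal H_finite_index id_part_subset_H rotation_set_H irrotational_normal
      irrotational_eq_group_irrotational by blast
qed

end
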